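(* Let $c\in\mathbb{C}$ and $r\ge 0$, and suppose that the interior of the closed disk $\overline{B}(c,r)=\{c'\in\mathbb{C}: |c'-c|\le r\}$ contains a superattracting parameter $\tilde c$. Then the following four statements are equivalent: (1) $r\le r_{\mathrm{bif}}(c)$; (2) for every $\omega\in\Omega_{c,r}$ the orbit $\{f^{(n)}_{\omega}(0)\}_{n\ge1}$ is bounded (hence $T_{c,r}(0)=0$); (3) the random Julia set $J_\omega$ is connected for every $\omega\in\Omega_{c,r}$; (4) the set $\overline{\bigcup_{g\in G_{c,r}}\{g(0)\}}$ is a planar minimal set of $G_{c,r}$. Also, the following four statements are equivalent: (1') $r> r_{\mathrm{bif}}(c)$; (2') for $\mathbb{P}_{c,r}$-almost every $\omega\in\Omega_{c,r}$, $f^{(n)}_{\omega}(0)\to\infty$ as $n\to\infty$, i.e. $T_{c,r}(0)=1$; (3') the random Julia set $J_\omega$ is totally disconnected for $\mathbb{P}_{c,r}$-almost every $\omega\in\Omega_{c,r}$; (4') the set $\overline{\bigcup_{g\in G_{c,r}}\{g(0)\}}$ is not bounded in $\mathbb{C}$. Furthermore, either the first group (1)–(4) or the second group (1')–(4') holds.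
   Context: Throughout, $f_c(z)=z^2+c$ for $c\in\mathbb{C}$, extended to the Riemann sphere $\widehat{\mathbb{C}}$ by $f_c(\infty)=\infty$. A parameter $\tilde c$ is superattracting if $f_{\tilde c}^{\circ p}(0)=0$ for some $p\in\mathbb{N}$. For $\omega=(c_n)_{n\ge1}\in\mathbb{C}^{\mathbb{N}}$ write $f^{(n)}_\omega=f_{c_n}\circ\cdots\circ f_{c_1}$. The random (non-autonomous) Julia set is $J_\omega=\{z\in\mathbb{C}:\{f^{(n)}_\omega\}_{n\ge1}$ is not normal on any neighborhood of $z\}$. For $r>0$ let $\mu_{c,r}$ be the normalized Lebesgue measure on $\overline{B}(c,r)$, and for $r=0$ the Dirac measure at $c$; $\mathbb{P}_{c,r}$ is the infinite product of $\mu_{c,r}$ on $\Omega_{c,r}=\prod_{n\ge1}\overline{B}(c,r)$ (Borel $\sigma$-algebra), and $T_{c,r}(z)=\mathbb{P}_{c,r}(\{\omega: f^{(n)}_\omega(z)\to\infty\})$. $G_{c,r}$ is the semigroup (under composition) generated by $\{f_{c'}:c'\in\overline{B}(c,r)\}$. For a polynomial semigroup $G$, a minimal set is a minimal element, with respect to inclusion, of the family of non-empty compact subsets $L\subset\widehat{\mathbb{C}}$ with $g(L)\subset L$ for all $g\in G$; it is planar if $\infty\notin L$. The bifurcation radius $r_{\mathrm{bif}}(c)$ is the supremum of those $r\ge0$ for which $G_{c,r}$ has a planar minimal set (equivalently the infimum of those $r\ge0$ for which $G_{c,r}$ has no planar minimal set); by prior work this value is attained, $G_{c,r}$ has a planar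 minimal set iff $r\le r_{\mathrm{bif}}(c)$, and $r_{\mathrm{bif}}(c)>0$ iff $f_c$ is hyperbolic with $c$ in the Mandelbrot set. *)

theory Defs
  imports "HOL-Probability.Probability"
begin

definition fq :: "complex \<Rightarrow> complex \<Rightarrow> complex" where
  "fq c z = z ^ 2 + c"

(* Non-autonomous iteration f^{(n)}_omega = f_{c_n} o ... o f_{c_1},
   where the sequence (c_n)_{n>=1} is encoded as omega :: nat => complex with c_{k} = omega (k-1). *)
fun seq_iter :: "(nat \<Rightarrow> complex) \<Rightarrow> nat \<Rightarrow> complex \<Rightarrow> complex" where
  "seq_iter \<omega> 0 = id"
| "seq_iter \<omega> (Suc n) = fq (\<omega> n) \<circ> seq_iter \<omega> n"

definition Omega :: "complex \<Rightarrow> real \<Rightarrow> (nat \<Rightarrow> complex) set" where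
  "Omega c r = {\<omega>. \<forall>n. \<omega> n \<in> cball c r}"

definition mu :: "complex \<Rightarrow> real \<Rightarrow> complex measure" where
  "mu c r = (if r = 0 then return lborel c else uniform_measure lborel (cball c r))"

definition Prob :: "complex \<Rightarrow> real \<Rightarrow> (nat \<Rightarrow> complex) measure" where
  "Prob c r = PiM UNIV (\<lambda>_::nat. mu c r)"

definition T :: "complex \<Rightarrow> real \<Rightarrow> complex \<Rightarrow> real" where
  "T c r z = measure (Prob c r)
     {\<omega> \<in> space (Prob c r). filterlim (\<lambda>n. seq_iter \<omega> n z) at_infinity sequentially}"

(* Normality (on the Riemann sphere) of a family of holomorphic maps on an open set U:
   every sequence in the family has a subsequence converging locally uniformly on U
   either to a (finite) limit function or to the constant infinity. *)
definition normal_family :: "(complex \<Rightarrow> complex) set \<Rightarrow> complex set \<Rightarrow> bool" where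
  "normal_family F U \<longleftrightarrow>
     (\<forall>g::nat \<Rightarrow> complex \<Rightarrow> complex. (\<forall>n. g n \<in> F) \<longrightarrow>
        (\<exists>\<sigma>::nat \<Rightarrow> nat. strict_mono \<sigma> \<and>
           ((\<exists>h. \<forall>K. compact K \<and> K \<subseteq> U \<longrightarrow> uniform_limit K (\<lambda>n. g (\<sigma> n)) h sequentially)
            \<or> (\<forall>K. compact K \<and> K \<subseteq> U \<longrightarrow>
                  (\<forall>M::real. eventually (\<lambda>n. \<forall>z\<in>K. M \<le> norm (g (\<sigma> n) z)) sequentially)))))"

definition julia :: "(nat \<Rightarrow> complex) \<Rightarrow> complex set" where
  "julia \<omega> = {z. \<not> (\<exists>U. open U \<and> z \<in> U \<and> normal_family (range (\<lambda>n. seq_iter \<omega> (Suc n))) U)}"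

definition totally_disconnected :: "'a::topological_space set \<Rightarrow> bool" where
  "totally_disconnected S \<longleftrightarrow> (\<forall>x\<in>S. connected_component_set S x = {x})"

definition superattracting :: "complex \<Rightarrow> bool" where
  "superattracting ct \<longleftrightarrow> (\<exists>p::nat. p \<ge> 1 \<and> (fq ct ^^ p) 0 = 0)"

inductive_set Gsg :: "complex \<Rightarrow> real \<Rightarrow> (complex \<Rightarrow> complex) set" for c r where
  gen: "c' \<in> cball c r \<Longrightarrow> fq c' \<in> Gsg c r"
| comp: "g \<in> Gsg c r \<Longrightarrow> h \<in> Gsg c r \<Longrightarrow> g \<circ> h \<in> Gsg c r"

(* planar minimal set: a minimal nonempty compact G-forward-invariant subset of the sphere
   not containing infinity; such a set is a compact subset of C, and all its
   compact invariant subsets are planar too. *)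
definition planar_minimal_set :: "(complex \<Rightarrow> complex) set \<Rightarrow> complex set \<Rightarrow> bool" where
  "planar_minimal_set G L \<longleftrightarrow>
     L \<noteq> {} \<and> compact L \<and> (\<forall>g\<in>G. g ` L \<subseteq> L) \<and>
     (\<forall>K. K \<subseteq> L \<and> K \<noteq> {} \<and> compact K \<and> (\<forall>g\<in>G. g ` K \<subseteq> K) \<longrightarrow> K = L)"

definition r_bif :: "complex \<Rightarrow> real" where
  "r_bif c = Sup {r. r \<ge> 0 \<and> (\<exists>L. planar_minimal_set (Gsg c r) L)}"

end

theory Submission
  imports Defs "HOL-Complex_Analysis.Complex_Analysis"
begin

text \<open>
  Everything hinges on whether the orbit of \<open>0\<close> under the semigroup is bounded.

  Every nonempty compact invariant set \<open>L\<close> contains \<open>0\<close>. Otherwise \<open>L\<close> has positive distance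
  from the finite orbit of \<open>0\<close> under the superattracting map, so inverse branches of its
  iterates exist on discs of a fixed radius centred in \<open>L\<close>, and the derivatives of the
  iterates on \<open>L\<close> are bounded below. Perturbing all parameters along an orbit at once keeps
  the orbit in \<open>L\<close>, and the Cauchy estimate bounds the sum of these derivatives along the
  orbit independently of its length, which is absurd.

  If the orbit of \<open>0\<close> is unbounded, then no compact set is invariant, every point escapes with
  positive probability, and by compactness survival probabilities decay geometrically,
  uniformly in the point. Hence almost surely the filled Julia set has no interior, and for
  some \<open>m\<close> there are infinitely many times \<open>k\<close> such that all critical points born before \<open>k\<close>
  have escaped by time \<open>k + m\<close>. A normal family argument for inverse branches at these times
  shows that the Julia set is totally disconnected. If the orbit of \<open>0\<close> is bounded, every
  filled Julia set is a nested intersection of connected preimages of a disc, and its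
  complement is connected by the maximum principle, so its boundary is connected.
\<close>

subsection \<open>Non-autonomous iteration\<close>

definition shift_seq :: "nat \<Rightarrow> (nat \<Rightarrow> 'a) \<Rightarrow> nat \<Rightarrow> 'a" where
  "shift_seq m \<omega> = (\<lambda>i. \<omega> (m + i))"

lemma shift_seq_apply: "shift_seq m \<omega> i = \<omega> (m + i)"
  by (simp add: shift_seq_def)

lemma shift_seq_0 [simp]: "shift_seq 0 \<omega> = \<omega>"
  by (simp add: shift_seq_def)

lemma shift_seq_const [simp]: "shift_seq m (\<lambda>_. a) = (\<lambda>_. a)"
  by (simp add: shift_seq_def)

lemma shift_seq_shift_seq [simp]: "shift_seq n (shift_seq m \<omega>) = shift_seq (m + n) \<omega>"
  by (simp add: shift_seq_def add.assoc)

lemma shift_seq_in_Omega: "\<omega> \<in> Omega c r \<Longrightarrow> shift_seq m \<omega> \<in> Omega c r"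
  by (simp add: Omega_def shift_seq_apply)

lemma Omega_mono: "r \<le> s \<Longrightarrow> Omega c r \<subseteq> Omega c s"
  by (auto simp: Omega_def intro: order_trans)

lemma seq_iter_add:
  "seq_iter \<omega> (m + n) z = seq_iter (shift_seq m \<omega>) n (seq_iter \<omega> m z)"
  by (induction n) (simp_all add: shift_seq_apply)

lemma seq_iter_Suc_shift:
  "seq_iter \<omega> (Suc n) z = seq_iter (shift_seq 1 \<omega>) n (fq (\<omega> 0) z)"
  using seq_iter_add[of \<omega> 1 n z] by simp

lemma seq_iter_const: "seq_iter (\<lambda>_. c) n = fq c ^^ n"
  by (induction n) simp_all

lemma seq_iter_cong:
  "(\<And>i. i < n \<Longrightarrow> \<omega> i = \<omega>' i) \<Longrightarrow> seq_iter \<omega> n z = seq_iter \<omega>' n z"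
  by (induction n) simp_all

lemma fq_uminus: "fq c (- z) = fq c z"
  by (simp add: fq_def)

lemma seq_iter_Suc_uminus: "seq_iter \<omega> (Suc n) (- z) = seq_iter \<omega> (Suc n) z"
  unfolding seq_iter_Suc_shift fq_uminus ..

lemma continuous_on_seq_iter [continuous_intros]:
  fixes z :: "'a::topological_space \<Rightarrow> complex"
  assumes "\<And>i. continuous_on S (\<lambda>x. \<omega> x i)" "continuous_on S z"
  shows "continuous_on S (\<lambda>x. seq_iter (\<omega> x) n (z x))"
  by (induction n) (auto simp: fq_def intro!: continuous_intros assms)

lemma holomorphic_on_seq_iter [holomorphic_intros]:
  assumes "\<And>i. (\<lambda>x. \<omega> x i) holomorphic_on S" "z holomorphic_on S"
  shows "(\<lambda>x. seq_iter (\<omega> x) n (z x)) holomorphic_on S"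
  by (induction n) (auto simp: fq_def intro!: holomorphic_intros assms)

lemma seq_iter_field_differentiable: "seq_iter \<omega> n field_differentiable at z"
  by (rule holomorphic_on_imp_differentiable_at[of _ UNIV]) (auto intro: holomorphic_intros)

lemma deriv_seq_iter_0 [simp]: "deriv (seq_iter \<omega> 0) z = 1"
  by (simp add: id_def)

lemma deriv_seq_iter_Suc:
  "deriv (seq_iter \<omega> (Suc n)) z = 2 * seq_iter \<omega> n z * deriv (seq_iter \<omega> n) z"
proof (rule DERIV_imp_deriv)
  note [derivative_intros] =
    field_differentiable_derivI[OF seq_iter_field_differentiable, THEN DERIV_chain2]
  show "(seq_iter \<omega> (Suc n) has_field_derivative
      2 * seq_iter \<omega> n z * deriv (seq_iter \<omega> n) z) (at z)"
    unfolding seq_iter.simps fq_def o_def by (auto intro!: derivative_eq_intros)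
qed

lemma seq_iter_Suc_in_Gsg: "\<omega> \<in> Omega c r \<Longrightarrow> seq_iter \<omega> (Suc n) \<in> Gsg c r"
proof (induction n)
  case 0
  then show ?case by (auto simp: Omega_def intro: Gsg.gen)
next
  case (Suc n)
  then have "fq (\<omega> (Suc n)) \<circ> seq_iter \<omega> (Suc n) \<in> Gsg c r"
    by (intro Gsg.comp Gsg.gen Suc.IH) (auto simp: Omega_def)
  then show ?case by (simp only: seq_iter.simps)
qed

lemma Gsg_imp_seq_iter: "g \<in> Gsg c r \<Longrightarrow> \<exists>\<omega>\<in>Omega c r. \<exists>n. g = seq_iter \<omega> (Suc n)"
proof (induction rule: Gsg.induct)
  case (gen c')
  then show ?case
    by (intro bexI[of _ "\<lambda>_. c'"] exI[of _ 0]) (auto simp: Omega_def)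
next
  case (comp g h)
  then obtain \<alpha> m \<beta> n where \<alpha>: "\<alpha> \<in> Omega c r" "g = seq_iter \<alpha> (Suc m)"
    and \<beta>: "\<beta> \<in> Omega c r" "h = seq_iter \<beta> (Suc n)" by blast
  let ?\<omega> = "comb_seq (Suc n) \<beta> \<alpha>"
  have "?\<omega> \<in> Omega c r" using \<alpha>(1) \<beta>(1) by (simp add: Omega_def comb_seq_def)
  moreover have "g \<circ> h = seq_iter ?\<omega> (Suc (Suc n + m))"
  proof
    fix z
    have "seq_iter ?\<omega> (Suc n + Suc m) z
        = seq_iter (shift_seq (Suc n) ?\<omega>) (Suc m) (seq_iter ?\<omega> (Suc n) z)"
      by (rule seq_iter_add)
    also have "shift_seq (Suc n) ?\<omega> = \<alpha>"
      by (simp add: fun_eq_iff comb_seq_def shift_seq_apply)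
    also have "seq_iter ?\<omega> (Suc n) z = h z"
      unfolding \<beta> by (rule seq_iter_cong) (simp add: comb_seq_less)
    finally show "(g \<circ> h) z = seq_iter ?\<omega> (Suc (Suc n + m)) z" by (simp add: \<alpha>)
  qed
  ultimately show ?case by blast
qed

abbreviation Gsg_orbit :: "complex \<Rightarrow> real \<Rightarrow> complex \<Rightarrow> complex set" where
  "Gsg_orbit c r z \<equiv> (\<Union>g\<in>Gsg c r. {g z})"

lemma Gsg_orbit_eq: "Gsg_orbit c r z = (\<Union>\<omega>\<in>Omega c r. range (\<lambda>n. seq_iter \<omega> (Suc n) z))"
  using Gsg_imp_seq_iter seq_iter_Suc_in_Gsg by (fastforce simp del: seq_iter.simps)

definition forward_invariant :: "complex set \<Rightarrow> complex set \<Rightarrow> bool" where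
  "forward_invariant B L \<longleftrightarrow> (\<forall>c\<in>B. fq c ` L \<subseteq> L)"

lemma forward_invariant_seq_iter:
  assumes "forward_invariant B L" "\<And>i. \<omega> i \<in> B" "z \<in> L"
  shows "seq_iter \<omega> n z \<in> L"
  using assms by (induction n) (auto simp: forward_invariant_def)

lemma forward_invariant_closure:
  assumes "forward_invariant B L"
  shows "forward_invariant B (closure L)"
  unfolding forward_invariant_def
proof
  fix c assume "c \<in> B"
  then have "fq c ` L \<subseteq> closure L"
    using assms closure_subset by (fastforce simp: forward_invariant_def)
  then show "fq c ` closure L \<subseteq> closure L"
    by (intro image_closure_subset) (auto simp: fq_def intro!: continuous_intros)
qed

lemma forward_invariant_cball_iff:
  "forward_invariant (cball c r) L \<longleftrightarrow> (\<forall>g\<in>Gsg c r. g ` L \<subseteq> L)"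
proof
  assume inv: "forward_invariant (cball c r) L"
  have "g ` L \<subseteq> L" if "g \<in> Gsg c r" for g
    using that
  proof induction
    case (gen c')
    then show ?case using inv by (simp add: forward_invariant_def)
  next
    case (comp g h)
    then show ?case by (auto simp: image_subset_iff)
  qed
  then show "\<forall>g\<in>Gsg c r. g ` L \<subseteq> L" ..
qed (use Gsg.gen in \<open>auto simp: forward_invariant_def\<close>)

lemma forward_invariant_Gsg_orbit: "forward_invariant (cball c r) (Gsg_orbit c r z)"
  unfolding forward_invariant_def
proof safe
  fix c' g assume "c' \<in> cball c r" "g \<in> Gsg c r"
  then have "fq c' \<circ> g \<in> Gsg c r" by (intro Gsg.comp Gsg.gen)
  then show "fq c' (g z) \<in> Gsg_orbit c r z" by (intro UN_I[of "fq c' \<circ> g"]) auto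
qed

subsection \<open>Escape radii\<close>

definition escape_radius :: "real \<Rightarrow> (nat \<Rightarrow> complex) \<Rightarrow> bool" where
  "escape_radius R \<omega> \<longleftrightarrow> (\<forall>n. cmod (\<omega> n) + 2 \<le> R)"

lemma escape_radius_shift_seq [simp]: "escape_radius R \<omega> \<Longrightarrow> escape_radius R (shift_seq m \<omega>)"
  by (simp add: escape_radius_def shift_seq_apply)

lemma escape_radius_ge_2: "escape_radius R \<omega> \<Longrightarrow> R \<ge> 2"
  unfolding escape_radius_def by (drule spec[of _ 0]) (use norm_ge_zero[of "\<omega> 0"] in linarith)

lemma mem_cball_imp_norm_le: "z \<in> cball c r \<Longrightarrow> norm z \<le> norm c + r"
  for c z :: "'a::real_normed_vector"
  using norm_triangle_sub[of z c] by (simp add: dist_norm norm_minus_commute)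

lemma Omega_escape_radius: "\<omega> \<in> Omega c r \<Longrightarrow> escape_radius (cmod c + r + 2) \<omega>"
  by (auto simp: escape_radius_def Omega_def intro: mem_cball_imp_norm_le[simplified])

lemma norm_fq_ge_double:
  assumes "cmod c + 2 \<le> cmod z"
  shows "2 * cmod z \<le> cmod (fq c z)"
proof -
  have "(cmod z - 1) * 2 \<le> (cmod z - 1) * cmod z"
    using assms norm_ge_zero[of c] by (intro mult_left_mono) linarith+
  moreover have "cmod (z^2) - cmod c \<le> cmod (fq c z)"
    unfolding fq_def by (rule norm_diff_ineq)
  ultimately show ?thesis
    using assms by (simp add: norm_mult power2_eq_square algebra_simps)
qed

lemma norm_seq_iter_ge:
  assumes "escape_radius R \<omega>" "R \<le> cmod z"
  shows "2 ^ n * cmod z \<le> cmod (seq_iter \<omega> n z)"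
proof (induction n)
  case (Suc n)
  have "1 * cmod z \<le> 2 ^ n * cmod z" by (intro mult_right_mono) auto
  then have "cmod (\<omega> n) + 2 \<le> cmod (seq_iter \<omega> n z)"
    using Suc assms unfolding escape_radius_def by (smt (verit))
  then show ?case using norm_fq_ge_double Suc by fastforce
qed simp

lemma norm_le_norm_seq_iter:
  assumes "escape_radius R \<omega>" "R \<le> cmod z"
  shows "cmod z \<le> cmod (seq_iter \<omega> n z)"
proof -
  have "1 * cmod z \<le> 2 ^ n * cmod z" by (intro mult_right_mono) auto
  then show ?thesis using norm_seq_iter_ge[OF assms, of n] by simp
qed

lemma norm_seq_iter_Suc_ge_double:
  assumes "escape_radius R \<omega>" "R \<le> cmod z"
  shows "2 * R \<le> cmod (seq_iter \<omega> (Suc n) z)"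
proof -
  have "2 * R \<le> 2 ^ Suc n * cmod z"
    using assms(2) escape_radius_ge_2[OF assms(1)] by (intro mult_mono) (auto simp: self_le_power)
  then show ?thesis using norm_seq_iter_ge[OF assms, of "Suc n"] by simp
qed

lemma norm_seq_iter_add_ge:
  assumes "escape_radius R \<omega>" "R < cmod (seq_iter \<omega> m z)"
  shows "2 ^ n * R \<le> cmod (seq_iter \<omega> (m + n) z)"
proof -
  have "2 ^ n * R \<le> 2 ^ n * cmod (seq_iter \<omega> m z)" using assms(2) by simp
  also have "\<dots> \<le> cmod (seq_iter (shift_seq m \<omega>) n (seq_iter \<omega> m z))"
    using assms by (intro norm_seq_iter_ge[where R=R]) auto
  finally show ?thesis by (simp add: seq_iter_add)
qed

lemma norm_seq_iter_le_antimono: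
  assumes "escape_radius R \<omega>" "cmod (seq_iter \<omega> n z) \<le> R" "m \<le> n"
  shows "cmod (seq_iter \<omega> m z) \<le> R"
proof (rule ccontr)
  assume escaped: "\<not> ?thesis"
  then have "cmod (seq_iter \<omega> m z) \<le> cmod (seq_iter (shift_seq m \<omega>) (n - m) (seq_iter \<omega> m z))"
    using assms(1) by (intro norm_le_norm_seq_iter[where R=R]) auto
  then show False
    using escaped assms(2,3) seq_iter_add[of \<omega> m "n - m" z] by simp
qed

lemma seq_iter_escape_uniform:
  assumes "escape_radius R \<omega>"
  obtains N where "\<And>m n z. R < cmod (seq_iter \<omega> m z) \<Longrightarrow> m + N \<le> n \<Longrightarrow> M \<le> cmod (seq_iter \<omega> n z)"
proof -
  obtain N where N: "M < 2 ^ N" using real_arch_pow[of 2 M] by auto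
  show ?thesis
  proof
    fix m n z assume escaped: "R < cmod (seq_iter \<omega> m z)" "m + N \<le> n"
    have "(2::real) ^ N \<le> 2 ^ (n - m)" using escaped by (intro power_increasing) auto
    also have "\<dots> * 1 \<le> 2 ^ (n - m) * R"
      using escape_radius_ge_2[OF assms] by (intro mult_left_mono) auto
    finally show "M \<le> cmod (seq_iter \<omega> n z)"
      using norm_seq_iter_add_ge[OF assms escaped(1), of "n - m"] escaped N by simp
  qed
qed

lemma seq_iter_tendsto_infinity:
  assumes "escape_radius R \<omega>" "R < cmod (seq_iter \<omega> m z)"
  shows "filterlim (\<lambda>n. seq_iter \<omega> n z) at_infinity sequentially"
  unfolding filterlim_at_infinity[OF order_refl] eventually_sequentially
  using seq_iter_escape_uniform[OF assms(1)] assms(2) by metis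

subsection \<open>Inverse branches\<close>

lemma holomorphic_sqrt_lift:
  fixes F q :: "'a::topological_space \<Rightarrow> complex"
  assumes U: "open U" "simply_connected U"
    and h: "h holomorphic_on U" "\<And>u. u \<in> U \<Longrightarrow> h u \<noteq> 0"
    and C: "connected C" "continuous_on C F" "F ` C \<subseteq> U"
    and q: "continuous_on C q" "\<And>y. y \<in> C \<Longrightarrow> q y ^ 2 = h (F y)"
  obtains s where "s holomorphic_on U" "\<And>u. u \<in> U \<Longrightarrow> s u ^ 2 = h u" "\<And>y. y \<in> C \<Longrightarrow> s (F y) = q y"
proof -
  obtain s where s: "s holomorphic_on U" "\<And>u. u \<in> U \<Longrightarrow> h u = s u ^ 2"
    using simply_connected_imp_holomorphic_sqrt[OF h(1) U(2) _ h(2)]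
      open_imp_locally_path_connected[OF U(1)] by blast
  have nonzero: "s (F y) \<noteq> 0" if "y \<in> C" for y
    using s(2)[of "F y"] h(2)[of "F y"] that C(3) by auto
  have "(q y / s (F y)) ^ 2 = 1" if "y \<in> C" for y
    using q(2)[OF that] s(2)[of "F y"] nonzero[OF that] that C(3) by (auto simp: power_divide)
  then have sign: "q y / s (F y) \<in> {1, -1}" if "y \<in> C" for y
    using that unfolding power2_eq_1_iff by blast
  have "(\<lambda>y. q y / s (F y)) constant_on C"
  proof (rule continuous_finite_range_constant[OF C(1)])
    show "finite ((\<lambda>y. q y / s (F y)) ` C)"
      by (rule finite_subset[of _ "{1, -1}"]) (use sign in blast, simp)
    have "continuous_on C (\<lambda>y. s (F y))"
      by (rule continuous_on_compose2[OF holomorphic_on_imp_continuous_on[OF s(1)] C(2,3)])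
    then show "continuous_on C (\<lambda>y. q y / s (F y))"
      using q(1) nonzero by (intro continuous_on_divide) auto
  qed
  then obtain b where b: "\<And>y. y \<in> C \<Longrightarrow> q y / s (F y) = b"
    unfolding constant_on_def by blast
  obtain a where a: "a \<in> {1, -1}" "\<And>y. y \<in> C \<Longrightarrow> q y / s (F y) = a"
  proof (cases "C = {}")
    case False
    then show ?thesis using sign b that[of b] by fastforce
  qed (use that[of 1] in simp)
  show ?thesis
  proof
    show "(\<lambda>u. a * s u) holomorphic_on U" by (intro holomorphic_intros s)
    show "(a * s u) ^ 2 = h u" if "u \<in> U" for u
      using a(1) s(2)[OF that] by auto
    show "a * s (F y) = q y" if "y \<in> C" for y
      using a(2)[OF that] nonzero[OF that] by (simp add: divide_eq_eq)
  qed
qed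

lemma inverse_branch:
  assumes U: "open U" "simply_connected U" and "connected C" "seq_iter \<omega> n ` C \<subseteq> U"
    and "\<And>m. m < n \<Longrightarrow> seq_iter (shift_seq m \<omega>) (n - m) 0 \<notin> U"
  shows "\<exists>g. g holomorphic_on U \<and> (\<forall>u\<in>U. seq_iter \<omega> n (g u) = u) \<and> (\<forall>y\<in>C. g (seq_iter \<omega> n y) = y)"
  using assms(3-)
proof (induction n arbitrary: \<omega> C)
  case 0
  then show ?case by (intro exI[of _ "\<lambda>u. u"]) auto
next
  case (Suc n)
  let ?\<omega> = "shift_seq 1 \<omega>" and ?F = "seq_iter \<omega> (Suc n)"
  have "\<exists>h. h holomorphic_on U \<and> (\<forall>u\<in>U. seq_iter ?\<omega> n (h u) = u) \<and>
      (\<forall>y\<in>fq (\<omega> 0) ` C. h (seq_iter ?\<omega> n y) = y)"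
  proof (rule Suc.IH)
    show "connected (fq (\<omega> 0) ` C)"
      unfolding fq_def by (intro connected_continuous_image continuous_intros Suc.prems)
    show "seq_iter ?\<omega> n ` fq (\<omega> 0) ` C \<subseteq> U"
      using Suc.prems(2) by (simp only: seq_iter_Suc_shift image_image)
    show "seq_iter (shift_seq m ?\<omega>) (n - m) 0 \<notin> U" if "m < n" for m
      using Suc.prems(3)[of "Suc m"] that by simp
  qed
  then obtain h where h: "h holomorphic_on U" "\<And>u. u \<in> U \<Longrightarrow> seq_iter ?\<omega> n (h u) = u"
    and h_inverse: "\<And>y. y \<in> C \<Longrightarrow> h (?F y) = fq (\<omega> 0) y"
    by (auto simp only: seq_iter_Suc_shift ball_simps)
  obtain s where s: "s holomorphic_on U" "\<And>u. u \<in> U \<Longrightarrow> s u ^ 2 = h u - \<omega> 0"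
    and s_inverse: "\<And>y. y \<in> C \<Longrightarrow> s (?F y) = y"
  proof (rule holomorphic_sqrt_lift[OF U _ _ Suc.prems(1) _ Suc.prems(2)])
    show "(\<lambda>u. h u - \<omega> 0) holomorphic_on U" by (intro holomorphic_intros h)
    show "h u - \<omega> 0 \<noteq> 0" if "u \<in> U" for u
    proof
      assume "h u - \<omega> 0 = 0"
      then have "?F 0 = u"
        using h(2)[OF that] by (simp only: seq_iter_Suc_shift) (simp add: fq_def)
      then show False using Suc.prems(3)[of 0] that by simp
    qed
    show "y ^ 2 = h (?F y) - \<omega> 0" if "y \<in> C" for y
      unfolding h_inverse[OF that] by (simp add: fq_def)
    show "continuous_on C ?F" "continuous_on C (\<lambda>y. y)" by (intro continuous_intros)+
  qed (rule that)
  have "?F (s u) = u" if "u \<in> U" for u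
  proof -
    have "fq (\<omega> 0) (s u) = h u" using s(2)[OF that] by (simp add: fq_def)
    then show ?thesis using h(2)[OF that] by (simp only: seq_iter_Suc_shift)
  qed
  then show ?case using s(1) s_inverse by blast
qed

subsection \<open>Invariant compact sets contain the critical point\<close>

lemma deriv_seq_iter_lower_bound:
  assumes R: "escape_radius R \<omega>" and "d > 0" and M: "cmod (seq_iter \<omega> n x) \<le> M"
    and far: "\<And>m. m < n \<Longrightarrow> d \<le> dist (seq_iter \<omega> n x) (seq_iter (shift_seq m \<omega>) (n - m) 0)"
  shows "d / (2 * (R + M + d)) \<le> cmod (deriv (seq_iter \<omega> n) x)"
proof -
  let ?F = "seq_iter \<omega> n"
  have "\<exists>g. g holomorphic_on ball (?F x) d \<and> (\<forall>u\<in>ball (?F x) d. ?F (g u) = u) \<and>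
      (\<forall>y\<in>{x}. g (?F y) = y)"
    using far \<open>d > 0\<close>
    by (intro inverse_branch) (auto simp: convex_imp_simply_connected not_less)
  then obtain g where g: "g holomorphic_on ball (?F x) d"
      "\<And>u. u \<in> ball (?F x) d \<Longrightarrow> ?F (g u) = u" "g (?F x) = x"
    by blast
  have M_pos: "M \<ge> 0" using M norm_ge_zero order_trans by blast
  have g_bound: "cmod (g u) \<le> R + M + d" if u: "u \<in> ball (?F x) d" for u
  proof (cases "R \<le> cmod (g u)")
    case True
    have "cmod (g u) \<le> cmod u" using norm_le_norm_seq_iter[OF R True, of n] g(2)[OF u] by simp
    also have "\<dots> \<le> cmod (?F x) + d" using u by (intro mem_cball_imp_norm_le) auto
    finally show ?thesis using M escape_radius_ge_2[OF R] by simp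
  qed (use M_pos \<open>d > 0\<close> in auto)
  have "cmod ((deriv ^^ 1) g (?F x)) \<le> fact 1 * (R + M + d) / (d/2) ^ 1"
  proof (rule Cauchy_inequality)
    show "continuous_on (cball (?F x) (d/2)) g"
      by (rule continuous_on_subset[OF holomorphic_on_imp_continuous_on[OF g(1)]])
        (use \<open>d > 0\<close> in auto)
    show "g holomorphic_on ball (?F x) (d/2)"
      by (rule holomorphic_on_subset[OF g(1)]) (use \<open>d > 0\<close> in auto)
    show "cmod (g v) \<le> R + M + d" if "cmod (?F x - v) = d/2" for v
      using that \<open>d > 0\<close> by (intro g_bound) (auto simp: dist_norm)
  qed (use \<open>d > 0\<close> in auto)
  then have deriv_g: "cmod (deriv g (?F x)) \<le> 2 * (R + M + d) / d" by (simp add: mult.commute)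
  have "deriv g (?F x) * deriv ?F (g (?F x)) = 1"
    by (rule deriv_left_inverse[OF g(1), of ?F UNIV])
      (use g(2) \<open>d > 0\<close> in \<open>auto intro: holomorphic_intros\<close>)
  then have "1 = cmod (deriv g (?F x)) * cmod (deriv ?F x)"
    unfolding g(3) by (metis norm_mult norm_one)
  also have "\<dots> \<le> 2 * (R + M + d) / d * cmod (deriv ?F x)"
    by (intro mult_right_mono deriv_g) simp
  finally show ?thesis
    using \<open>d > 0\<close> M_pos escape_radius_ge_2[OF R] by (simp add: field_simps)
qed

text \<open>The derivative of \<open>f\<^sub>\<omega>\<^sup>(\<^sup>n\<^sup>)(z)\<close> with respect to the parameter \<open>\<omega> j\<close>, for \<open>j < n\<close>.\<close>

definition parameter_deriv :: "(nat \<Rightarrow> complex) \<Rightarrow> nat \<Rightarrow> complex \<Rightarrow> nat \<Rightarrow> complex" where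
  "parameter_deriv \<omega> n z j =
    deriv (seq_iter (shift_seq (Suc j) \<omega>) (n - Suc j)) (seq_iter \<omega> (Suc j) z)"

lemma parameter_deriv_Suc:
  assumes "j < n"
  shows "parameter_deriv \<omega> (Suc n) z j = 2 * seq_iter \<omega> n z * parameter_deriv \<omega> n z j"
proof -
  have "seq_iter (shift_seq (Suc j) \<omega>) (n - Suc j) (seq_iter \<omega> (Suc j) z) = seq_iter \<omega> n z"
    using seq_iter_add[of \<omega> "Suc j" "n - Suc j" z] assms by simp
  moreover have "Suc n - Suc j = Suc (n - Suc j)" using assms by simp
  ultimately show ?thesis by (simp only: parameter_deriv_def deriv_seq_iter_Suc)
qed

lemma has_field_derivative_perturbed_seq_iter:
  "((\<lambda>t. seq_iter (\<lambda>i. \<omega> i + t * a i) n z) has_field_derivative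
    (\<Sum>j<n. a j * parameter_deriv \<omega> n z j)) (at 0)"
  (is "(?F n has_field_derivative ?D n) _")
proof (induction n)
  case 0
  then show ?case by simp
next
  case (Suc n)
  have "parameter_deriv \<omega> (Suc n) z n = 1" by (simp add: parameter_deriv_def)
  then have "?D (Suc n) = 2 * seq_iter \<omega> n z * ?D n + a n"
    by (simp add: parameter_deriv_Suc sum_distrib_left mult_ac)
  moreover have "((\<lambda>t. ?F n t ^ 2 + (\<omega> n + t * a n)) has_field_derivative
      2 * seq_iter \<omega> n z * ?D n + a n) (at 0)"
    by (rule derivative_eq_intros Suc refl)+ simp
  ultimately show ?case by (simp add: fq_def)
qed

text \<open>All parameters are moved simultaneously, with phases that align the first-order effects.\<close>

lemma sum_parameter_deriv_le:
  assumes inv: "forward_invariant B L" and B: "\<And>i. cball (\<omega> i) \<eta> \<subseteq> B"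
    and "\<eta> \<ge> 0" "x \<in> L" and M: "\<And>z. z \<in> L \<Longrightarrow> cmod z \<le> M"
  shows "\<eta> * (\<Sum>j<n. cmod (parameter_deriv \<omega> n x j)) \<le> M"
proof -
  define w where "w = parameter_deriv \<omega> n x"
  define a where "a j = of_real \<eta> * cnj (sgn (w j))" for j
  define F where "F t = seq_iter (\<lambda>i. \<omega> i + t * a i) n x" for t
  have "a j * w j = of_real (\<eta> * cmod (w j))" for j
  proof -
    have "cnj (sgn (w j)) * w j = w j * cnj (w j) / of_real (cmod (w j))"
      by (simp add: sgn_div_norm scaleR_conv_of_real field_simps)
    also have "\<dots> = of_real (cmod (w j))"
      by (simp add: complex_norm_square[symmetric] power2_eq_square)
    finally show ?thesis by (simp add: a_def mult.assoc)
  qed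
  moreover have "deriv F 0 = (\<Sum>j<n. a j * w j)"
    unfolding F_def w_def by (rule DERIV_imp_deriv[OF has_field_derivative_perturbed_seq_iter])
  ultimately have "deriv F 0 = of_real (\<eta> * (\<Sum>j<n. cmod (w j)))"
    by (simp add: sum_distrib_left)
  then have "cmod (deriv F 0) = \<eta> * (\<Sum>j<n. cmod (w j))"
    using \<open>\<eta> \<ge> 0\<close> by (simp only: norm_of_real) (simp add: sum_nonneg)
  moreover have "cmod ((deriv ^^ 1) F 0) \<le> fact 1 * M / 1 ^ 1"
  proof (rule Cauchy_inequality)
    show "F holomorphic_on ball 0 1" "continuous_on (cball 0 1) F"
      unfolding F_def by (intro holomorphic_intros continuous_intros)+
    fix t :: complex assume "cmod (0 - t) = 1"
    then have "\<omega> i + t * a i \<in> cball (\<omega> i) \<eta>" for i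
      using \<open>\<eta> \<ge> 0\<close> by (simp add: a_def dist_norm norm_mult norm_sgn)
    then show "cmod (F t) \<le> M"
      unfolding F_def using B by (intro M forward_invariant_seq_iter[OF inv _ \<open>x \<in> L\<close>]) blast
  qed simp
  ultimately show ?thesis by (simp add: w_def)
qed

lemma forward_invariant_imp_escape_radius:
  assumes "forward_invariant B L" "x \<in> L" and M: "\<And>z. z \<in> L \<Longrightarrow> cmod z \<le> M"
    and "\<And>i. \<omega> i \<in> B"
  shows "escape_radius (M + M\<^sup>2 + 2) \<omega>"
proof -
  have "cmod (\<omega> i) \<le> M + M\<^sup>2" for i
  proof -
    have "fq (\<omega> i) x \<in> L" using assms by (auto simp: forward_invariant_def)
    then have "cmod (fq (\<omega> i) x) + cmod x ^ 2 \<le> M + M\<^sup>2"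
      using M \<open>x \<in> L\<close> by (intro add_mono power_mono) auto
    moreover have "\<omega> i = fq (\<omega> i) x - x ^ 2" by (simp add: fq_def)
    ultimately show ?thesis
      using norm_triangle_ineq4[of "fq (\<omega> i) x" "x ^ 2"] by (simp add: norm_power)
  qed
  then show ?thesis by (simp add: escape_radius_def)
qed

lemma critical_orbits_approach_invariant_set:
  assumes inv: "forward_invariant B L" and "bounded L" "x \<in> L"
    and B: "\<And>i. cball (\<omega> i) \<eta> \<subseteq> B" and "\<eta> > 0" "d > 0"
  shows "\<exists>m n. \<exists>y\<in>L. dist y (seq_iter (shift_seq m \<omega>) n 0) < d"
proof (rule ccontr)
  assume "\<not> ?thesis"
  then have far: "d \<le> dist y (seq_iter (shift_seq m \<omega>) n 0)" if "y \<in> L" for y m n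
    using that by (meson not_less)
  obtain M where M: "\<And>z. z \<in> L \<Longrightarrow> cmod z \<le> M"
    using \<open>bounded L\<close> unfolding bounded_iff by blast
  have \<omega>_B: "\<omega> i \<in> B" for i using subsetD[OF B, of "\<omega> i" i] \<open>\<eta> > 0\<close> by simp
  have R: "escape_radius (M + M\<^sup>2 + 2) \<omega>"
    by (rule forward_invariant_imp_escape_radius[OF inv \<open>x \<in> L\<close> M \<omega>_B])
  have "M \<ge> 0" using M[OF \<open>x \<in> L\<close>] norm_ge_zero order_trans by blast
  define \<kappa> where "\<kappa> = d / (2 * (M + M\<^sup>2 + 2 + M + d))"
  have "\<kappa> > 0" using \<open>d > 0\<close> \<open>M \<ge> 0\<close> by (simp add: \<kappa>_def add_nonneg_pos)
  have expansion: "\<kappa> \<le> cmod (parameter_deriv \<omega> n x j)" for j n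
  proof -
    have "seq_iter (shift_seq (Suc j) \<omega>) (n - Suc j) (seq_iter \<omega> (Suc j) x) \<in> L"
      using \<omega>_B \<open>x \<in> L\<close>
      by (intro forward_invariant_seq_iter[OF inv]) (simp_all only: shift_seq_apply)
    then show ?thesis
      unfolding \<kappa>_def parameter_deriv_def using R \<open>d > 0\<close> far M
      by (intro deriv_seq_iter_lower_bound) auto
  qed
  have bounded_length: "real n * (\<eta> * \<kappa>) \<le> M" for n
  proof -
    have "real n * \<kappa> = (\<Sum>j<n. \<kappa>)" by simp
    also have "\<dots> \<le> (\<Sum>j<n. cmod (parameter_deriv \<omega> n x j))"
      by (intro sum_mono expansion)
    finally have "\<eta> * (real n * \<kappa>) \<le> \<eta> * \<dots>" using \<open>\<eta> > 0\<close> by simp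
    also have "\<dots> \<le> M"
      using \<open>\<eta> > 0\<close> by (intro sum_parameter_deriv_le[OF inv B _ \<open>x \<in> L\<close> M]) auto
    finally show ?thesis by (simp add: mult_ac)
  qed
  obtain n where "M < real n * (\<eta> * \<kappa>)"
    using reals_Archimedean3[of "\<eta> * \<kappa>"] \<open>\<eta> > 0\<close> \<open>\<kappa> > 0\<close> by auto
  then show False using bounded_length[of n] by simp
qed

lemma superattracting_imp_finite_critical_orbit:
  assumes "superattracting c"
  shows "finite (range (\<lambda>n. (fq c ^^ n) 0))"
proof -
  obtain p where p: "p \<ge> 1" "(fq c ^^ p) 0 = 0"
    using assms unfolding superattracting_def by blast
  have "range (\<lambda>n. (fq c ^^ n) 0) \<subseteq> (\<lambda>n. (fq c ^^ n) 0) ` {..<p}"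
  proof (rule image_subsetI)
    fix n
    have "(fq c ^^ n) 0 = (fq c ^^ (n mod p)) 0" by (rule funpow_mod_eq[OF p(2), symmetric])
    then show "(fq c ^^ n) 0 \<in> (\<lambda>n. (fq c ^^ n) 0) ` {..<p}" using p(1) by auto
  qed
  then show ?thesis by (rule finite_subset) simp
qed

lemma superattracting_imp_critical_orbit_returns:
  assumes "superattracting c"
  shows "\<exists>m. (fq c ^^ m) ((fq c ^^ n) 0) = 0"
proof -
  obtain p where p: "p \<ge> 1" "(fq c ^^ p) 0 = 0"
    using assms unfolding superattracting_def by blast
  have "(fq c ^^ (p * n - n)) ((fq c ^^ n) 0) = (fq c ^^ (p * n - n + n)) 0"
    by (simp only: funpow_add o_apply)
  also have "p * n - n + n = p * n" using p(1) by simp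
  also have "(fq c ^^ (p * n)) 0 = 0" using funpow_mod_eq[OF p(2), of "p * n"] by simp
  finally show ?thesis ..
qed

lemma superattracting_imp_zero_in_invariant_set:
  assumes ct: "superattracting ct" "ct \<in> interior B"
    and inv: "forward_invariant B L" and "compact L" "L \<noteq> {}"
  shows "0 \<in> L"
proof (rule ccontr)
  assume "0 \<notin> L"
  define P where "P = range (\<lambda>n. (fq ct ^^ n) 0)"
  have "closed P"
    unfolding P_def by (intro finite_imp_closed superattracting_imp_finite_critical_orbit ct(1))
  moreover have "L \<inter> P = {}"
  proof (rule ccontr)
    assume "L \<inter> P \<noteq> {}"
    then obtain n where "(fq ct ^^ n) 0 \<in> L" by (auto simp: P_def)
    moreover have "ct \<in> B" using ct(2) interior_subset by blast
    ultimately have "(fq ct ^^ m) ((fq ct ^^ n) 0) \<in> L" for m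
      unfolding seq_iter_const[symmetric] by (rule forward_invariant_seq_iter[OF inv, rotated])
    then show False
      using superattracting_imp_critical_orbit_returns[OF ct(1)] \<open>0 \<notin> L\<close> by metis
  qed
  ultimately obtain d where d: "d > 0" "\<And>x y. x \<in> L \<Longrightarrow> y \<in> P \<Longrightarrow> d \<le> dist x y"
    using separate_compact_closed[OF \<open>compact L\<close>, of P] by blast
  obtain \<eta> where \<eta>: "\<eta> > 0" "cball ct \<eta> \<subseteq> B" using ct(2) unfolding mem_interior_cball by blast
  obtain x where "x \<in> L" using \<open>L \<noteq> {}\<close> by blast
  have "\<exists>m n. \<exists>y\<in>L. dist y (seq_iter (shift_seq m (\<lambda>_. ct)) n 0) < d"
    by (rule critical_orbits_approach_invariant_set[OF inv _ \<open>x \<in> L\<close> \<eta>(2,1) d(1)])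
      (rule compact_imp_bounded[OF \<open>compact L\<close>])
  then obtain n y where "y \<in> L" "dist y ((fq ct ^^ n) 0) < d" by (auto simp: seq_iter_const)
  moreover have "(fq ct ^^ n) 0 \<in> P" by (simp add: P_def)
  ultimately show False using d(2) by fastforce
qed

subsection \<open>Normal families\<close>

lemma normal_family_locally_bounded:
  assumes "open U" "\<And>f. f \<in> F \<Longrightarrow> f holomorphic_on U"
    and "\<And>K. compact K \<Longrightarrow> K \<subseteq> U \<Longrightarrow> \<exists>B. \<forall>f\<in>F. \<forall>z\<in>K. cmod (f z) \<le> B"
  shows "normal_family F U"
  unfolding normal_family_def
proof (intro allI impI)
  fix g :: "nat \<Rightarrow> complex \<Rightarrow> complex" assume g: "\<forall>n. g n \<in> F"
  obtain h \<sigma> where "strict_mono (\<sigma> :: nat \<Rightarrow> nat)"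
    "\<And>K. compact K \<Longrightarrow> K \<subseteq> U \<Longrightarrow> uniform_limit K (g \<circ> \<sigma>) h sequentially"
    by (rule Montel[of U F g]) (use assms g in auto)
  then show "\<exists>\<sigma>. strict_mono \<sigma> \<and>
      ((\<exists>h. \<forall>K. compact K \<and> K \<subseteq> U \<longrightarrow> uniform_limit K (\<lambda>n. g (\<sigma> n)) h sequentially) \<or>
       (\<forall>K. compact K \<and> K \<subseteq> U \<longrightarrow> (\<forall>M. \<forall>\<^sub>F n in sequentially. \<forall>z\<in>K. M \<le> cmod (g (\<sigma> n) z))))"
    unfolding o_def by blast
qed

lemma nat_seq_constant_or_divergent_subseq:
  fixes f :: "nat \<Rightarrow> nat"
  obtains (const) \<sigma> k where "strict_mono (\<sigma> :: nat \<Rightarrow> nat)" "\<And>n. f (\<sigma> n) = k"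
  | (divergent) \<sigma> where "strict_mono (\<sigma> :: nat \<Rightarrow> nat)"
      "filterlim (\<lambda>n. f (\<sigma> n)) at_top sequentially"
proof (cases "\<exists>k. infinite (f -` {k})")
  case True
  then obtain k where k: "infinite (f -` {k})" ..
  show ?thesis
  proof (rule const)
    show "strict_mono (enumerate (f -` {k}))" using k by (rule strict_mono_enumerate)
    show "f (enumerate (f -` {k}) n) = k" for n using enumerate_in_set[OF k, of n] by simp
  qed
next
  case False
  have "eventually (\<lambda>n. N \<le> f n) sequentially" for N
  proof -
    have "f -` {..<N} = (\<Union>k<N. f -` {k})" by auto
    also have "finite \<dots>" using False by blast
    finally have "eventually (\<lambda>n. n \<notin> f -` {..<N}) cofinite"
      by (simp only: eventually_cofinite not_not Collect_mem_eq)
    then show ?thesis by (simp add: cofinite_eq_sequentially not_less)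
  qed
  then have "filterlim f at_top sequentially" by (simp add: filterlim_at_top)
  then show ?thesis using divergent[of id] by (simp add: strict_mono_def)
qed

lemma normal_family_range_escaping:
  assumes escaping: "\<And>K M. compact K \<Longrightarrow> K \<subseteq> U \<Longrightarrow> \<forall>\<^sub>F n in sequentially. \<forall>z\<in>K. M \<le> cmod (f n z)"
  shows "normal_family (range f) U"
  unfolding normal_family_def
proof (intro allI impI)
  fix g :: "nat \<Rightarrow> complex \<Rightarrow> complex" assume "\<forall>n. g n \<in> range f"
  then obtain k where k: "\<And>n. g n = f (k n)" unfolding image_iff by metis
  consider (const) \<sigma> l where "strict_mono (\<sigma> :: nat \<Rightarrow> nat)" "\<And>n. k (\<sigma> n) = l"
    | (divergent) \<sigma> where "strict_mono (\<sigma> :: nat \<Rightarrow> nat)"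
        "filterlim (\<lambda>n. k (\<sigma> n)) at_top sequentially"
    by (rule nat_seq_constant_or_divergent_subseq[of k]) blast
  then show "\<exists>\<sigma>. strict_mono \<sigma> \<and>
      ((\<exists>h. \<forall>K. compact K \<and> K \<subseteq> U \<longrightarrow> uniform_limit K (\<lambda>n. g (\<sigma> n)) h sequentially) \<or>
       (\<forall>K. compact K \<and> K \<subseteq> U \<longrightarrow> (\<forall>M. \<forall>\<^sub>F n in sequentially. \<forall>z\<in>K. M \<le> cmod (g (\<sigma> n) z))))"
  proof cases
    case (const \<sigma> l)
    then have "uniform_limit K (\<lambda>n. g (\<sigma> n)) (f l) sequentially" for K
      by (simp add: k uniform_limit_const)
    then show ?thesis using const(1) by blast
  next
    case (divergent \<sigma>)
    have "\<forall>\<^sub>F n in sequentially. \<forall>z\<in>K. M \<le> cmod (g (\<sigma> n) z)" if "compact K" "K \<subseteq> U" for K M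
      unfolding k by (rule eventually_compose_filterlim[OF escaping[OF that] divergent(2)])
    then show ?thesis using divergent(1) by blast
  qed
qed

lemma normal_family_range_imp_not_escaping:
  assumes "normal_family (range f) U" "z \<in> U" "w \<in> U" "bounded (range (\<lambda>n. f n z))"
  shows "\<not> filterlim (\<lambda>n. f n w) at_infinity sequentially"
proof
  assume w: "filterlim (\<lambda>n. f n w) at_infinity sequentially"
  obtain B where B: "\<And>n. cmod (f n z) \<le> B" using assms(4) unfolding bounded_iff by blast
  obtain \<sigma> where \<sigma>: "strict_mono (\<sigma> :: nat \<Rightarrow> nat)"
    and "(\<exists>h. \<forall>K. compact K \<and> K \<subseteq> U \<longrightarrow> uniform_limit K (\<lambda>n. f (\<sigma> n)) h sequentially) \<or>
      (\<forall>K. compact K \<and> K \<subseteq> U \<longrightarrow> (\<forall>M. \<forall>\<^sub>F n in sequentially. \<forall>z\<in>K. M \<le> cmod (f (\<sigma> n) z)))"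
    using assms(1)[unfolded normal_family_def, rule_format, of f] by blast
  then consider (limit) h where "uniform_limit {w} (\<lambda>n. f (\<sigma> n)) h sequentially"
    | (escape) "\<forall>\<^sub>F n in sequentially. \<forall>y\<in>{z}. B + 1 \<le> cmod (f (\<sigma> n) y)"
    using assms(2,3) by (meson compact_sing empty_subsetI insert_subset)
  then show False
  proof cases
    case limit
    then have "(\<lambda>n. f (\<sigma> n) w) \<longlonglongrightarrow> h w" by (rule tendsto_uniform_limitI) simp
    moreover have "filterlim (\<lambda>n. f (\<sigma> n) w) at_infinity sequentially"
      by (rule filterlim_compose[OF w filterlim_subseq[OF \<sigma>]])
    ultimately show False using not_tendsto_and_filterlim_at_infinity by force
  next
    case escape
    then obtain n where "B + 1 \<le> cmod (f (\<sigma> n) z)"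
      using eventually_happens'[OF sequentially_bot] by auto
    then show False using B[of "\<sigma> n"] by simp
  qed
qed

subsection \<open>Filled Julia sets\<close>

definition filled_julia :: "(nat \<Rightarrow> complex) \<Rightarrow> complex set" where
  "filled_julia \<omega> = {z. bounded (range (\<lambda>n. seq_iter \<omega> n z))}"

lemma bounded_range_Suc_iff:
  fixes f :: "nat \<Rightarrow> 'a::metric_space"
  shows "bounded (range (\<lambda>n. f (Suc n))) \<longleftrightarrow> bounded (range f)"
proof -
  have "range f = insert (f 0) (range (\<lambda>n. f (Suc n)))"
    by (auto simp: image_iff) (metis not0_implies_Suc)
  then show ?thesis by simp
qed

lemma filled_julia_iff_bounded_Suc:
  "z \<in> filled_julia \<omega> \<longleftrightarrow> bounded (range (\<lambda>n. seq_iter \<omega> (Suc n) z))"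
  unfolding filled_julia_def mem_Collect_eq by (rule bounded_range_Suc_iff[symmetric])

lemma filterlim_at_infinity_imp_unbounded:
  fixes f :: "nat \<Rightarrow> 'a::real_normed_vector"
  assumes "filterlim f at_infinity sequentially"
  shows "\<not> bounded (range f)"
proof
  assume "bounded (range f)"
  then obtain B where B: "B > 0" "\<And>n. norm (f n) \<le> B" unfolding bounded_pos by blast
  have "\<forall>\<^sub>F n in sequentially. B + 1 \<le> norm (f n)"
    using assms \<open>B > 0\<close> unfolding filterlim_at_infinity[OF order_refl] by simp
  then obtain n where "B + 1 \<le> norm (f n)"
    using eventually_happens'[OF sequentially_bot] by blast
  then show False using B(2)[of n] by simp
qed

lemma filled_julia_iff:
  assumes "escape_radius R \<omega>"
  shows "z \<in> filled_julia \<omega> \<longleftrightarrow> (\<forall>n. cmod (seq_iter \<omega> n z) \<le> R)"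
proof
  show "\<forall>n. cmod (seq_iter \<omega> n z) \<le> R" if "z \<in> filled_julia \<omega>"
    using that seq_iter_tendsto_infinity[OF assms] filterlim_at_infinity_imp_unbounded
    unfolding filled_julia_def by (metis mem_Collect_eq not_less)
qed (auto simp: filled_julia_def bounded_iff)

lemma not_in_filled_julia_iff:
  assumes "escape_radius R \<omega>"
  shows "z \<notin> filled_julia \<omega> \<longleftrightarrow> filterlim (\<lambda>n. seq_iter \<omega> n z) at_infinity sequentially"
proof
  show "filterlim (\<lambda>n. seq_iter \<omega> n z) at_infinity sequentially" if "z \<notin> filled_julia \<omega>"
    using that seq_iter_tendsto_infinity[OF assms] filled_julia_iff[OF assms] by (auto simp: not_le)
qed (auto simp: filled_julia_def dest: filterlim_at_infinity_imp_unbounded)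

lemma filled_julia_eq_INT:
  "escape_radius R \<omega> \<Longrightarrow> filled_julia \<omega> = (\<Inter>n. {z. cmod (seq_iter \<omega> n z) \<le> R})"
  by (auto simp: filled_julia_iff)

lemma filled_julia_uminus: "- z \<in> filled_julia \<omega> \<longleftrightarrow> z \<in> filled_julia \<omega>"
  by (simp only: filled_julia_iff_bounded_Suc seq_iter_Suc_uminus)

lemma compact_seq_iter_le:
  assumes "escape_radius R \<omega>"
  shows "compact {z. cmod (seq_iter \<omega> n z) \<le> R}"
  unfolding compact_eq_bounded_closed
proof
  have "{z. cmod (seq_iter \<omega> n z) \<le> R} \<subseteq> cball 0 R"
    using norm_seq_iter_le_antimono[OF assms, of n _ 0] by auto
  then show "bounded {z. cmod (seq_iter \<omega> n z) \<le> R}"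
    using bounded_subset bounded_cball by blast
  show "closed {z. cmod (seq_iter \<omega> n z) \<le> R}"
    by (intro closed_Collect_le continuous_intros)
qed

lemma compact_filled_julia: "escape_radius R \<omega> \<Longrightarrow> compact (filled_julia \<omega>)"
  unfolding filled_julia_eq_INT by (intro compact_Inter) (auto intro: compact_seq_iter_le)

text \<open>Of the two square roots of a number, one has distance at least its own modulus from a given
  parameter, so points can be pulled back without entering the open unit disc.\<close>

lemma exists_large_seq_iter_le:
  assumes "escape_radius R \<omega>"
  shows "\<exists>z. 1 \<le> cmod z \<and> cmod (seq_iter \<omega> n z) \<le> R"
  using assms
proof (induction n arbitrary: \<omega>)
  case 0
  then show ?case using escape_radius_ge_2 by (intro exI[of _ 1]) fastforce
next
  case (Suc n)
  then obtain w where w: "1 \<le> cmod w" "cmod (seq_iter (shift_seq 1 \<omega>) n w) \<le> R"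
    using escape_radius_shift_seq by blast
  have "R \<ge> 0" using escape_radius_ge_2[OF Suc.prems] by simp
  obtain v where v: "cmod (seq_iter (shift_seq 1 \<omega>) n v) \<le> R" "1 \<le> cmod (v - \<omega> 0)"
  proof (cases "1 \<le> cmod (w - \<omega> 0)")
    case False
    have "cmod (seq_iter (shift_seq 1 \<omega>) n (- w)) \<le> R"
      using w(2) by (cases n) (simp_all only: seq_iter_Suc_uminus, simp)
    moreover have "1 \<le> cmod (- w - \<omega> 0)"
      using norm_triangle_ineq4[of "w - \<omega> 0" "- w - \<omega> 0"] w(1) False
      by (simp add: norm_mult flip: mult_2)
    ultimately show ?thesis by (rule that)
  qed (use w that in blast)
  show ?case
  proof (intro exI conjI)
    show "1 \<le> cmod (csqrt (v - \<omega> 0))" using v(2) by (simp add: norm_csqrt)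
    show "cmod (seq_iter \<omega> (Suc n) (csqrt (v - \<omega> 0))) \<le> R"
      using v(1) by (simp only: seq_iter_Suc_shift) (simp add: fq_def)
  qed
qed

lemma filled_julia_large_point:
  assumes "escape_radius R \<omega>"
  shows "\<exists>z\<in>filled_julia \<omega>. 1 \<le> cmod z"
proof -
  let ?S = "\<lambda>n. {z. cmod (seq_iter \<omega> n z) \<le> R} \<inter> {z. 1 \<le> cmod z}"
  have "(\<Inter>n. ?S n) \<noteq> {}"
  proof (rule compact_nest)
    show "compact (?S n)" for n
      by (intro compact_Int_closed compact_seq_iter_le[OF assms]
          closed_Collect_le continuous_intros)
    show "?S n \<noteq> {}" for n using exists_large_seq_iter_le[OF assms] by blast
    show "?S n \<subseteq> ?S m" if "m \<le> n" for m n
      using norm_seq_iter_le_antimono[OF assms _ that] by blast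
  qed
  then show ?thesis using filled_julia_eq_INT[OF assms] by blast
qed

subsection \<open>The Julia set is the boundary of the filled Julia set\<close>

lemma julia_subset_filled_julia:
  assumes R: "escape_radius R \<omega>"
  shows "julia \<omega> \<subseteq> filled_julia \<omega>"
proof
  fix z assume "z \<in> julia \<omega>"
  show "z \<in> filled_julia \<omega>"
  proof (rule ccontr)
    assume "z \<notin> filled_julia \<omega>"
    then obtain m where m: "R < cmod (seq_iter \<omega> m z)" by (auto simp: filled_julia_iff[OF R] not_le)
    let ?U = "{y. R < cmod (seq_iter \<omega> m y)}"
    have "normal_family (range (\<lambda>n. seq_iter \<omega> (Suc n))) ?U"
    proof (rule normal_family_range_escaping)
      fix K M assume K: "K \<subseteq> ?U"
      obtain N where N: "\<And>m n z. R < cmod (seq_iter \<omega> m z) \<Longrightarrow> m + N \<le> n \<Longrightarrow> M \<le> cmod (seq_iter \<omega> n z)"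
        using seq_iter_escape_uniform[OF R] by blast
      have "\<forall>z\<in>K. M \<le> cmod (seq_iter \<omega> (Suc n) z)" if "m + N \<le> n" for n
        using N[of m _ "Suc n"] K that by auto
      then show "\<forall>\<^sub>F n in sequentially. \<forall>z\<in>K. M \<le> cmod (seq_iter \<omega> (Suc n) z)"
        unfolding eventually_sequentially by blast
    qed
    moreover have "open ?U" by (intro open_Collect_less continuous_intros)
    ultimately show False using \<open>z \<in> julia \<omega>\<close> m unfolding julia_def by blast
  qed
qed

lemma julia_Int_interior_filled_julia:
  assumes R: "escape_radius R \<omega>"
  shows "julia \<omega> \<inter> interior (filled_julia \<omega>) = {}"
proof -
  let ?U = "interior (filled_julia \<omega>)"
  have "normal_family (range (\<lambda>n. seq_iter \<omega> (Suc n))) ?U"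
  proof (rule normal_family_locally_bounded)
    fix K assume "K \<subseteq> ?U"
    then have "cmod (seq_iter \<omega> n z) \<le> R" if "z \<in> K" for n z
      using that interior_subset filled_julia_iff[OF R] by blast
    then show "\<exists>B. \<forall>f\<in>range (\<lambda>n. seq_iter \<omega> (Suc n)). \<forall>z\<in>K. cmod (f z) \<le> B" by blast
  qed (auto intro!: holomorphic_intros simp del: seq_iter.simps)
  then show ?thesis by (auto simp: julia_def)
qed

lemma frontier_filled_julia_subset_julia:
  assumes R: "escape_radius R \<omega>"
  shows "frontier (filled_julia \<omega>) \<subseteq> julia \<omega>"
proof
  fix z assume z: "z \<in> frontier (filled_julia \<omega>)"
  then have "z \<in> filled_julia \<omega>"
    using frontier_subset_compact[OF compact_filled_julia[OF R]] by blast
  show "z \<in> julia \<omega>"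
  proof (rule ccontr)
    assume "z \<notin> julia \<omega>"
    then obtain U where U: "open U" "z \<in> U" "normal_family (range (\<lambda>n. seq_iter \<omega> (Suc n))) U"
      unfolding julia_def by blast
    obtain w where w: "w \<in> U" "w \<notin> filled_julia \<omega>"
      using z U(1,2) interior_maximal[of U "filled_julia \<omega>"] unfolding frontier_def by blast
    have "filterlim (\<lambda>n. seq_iter \<omega> (Suc n) w) at_infinity sequentially"
      using w(2) not_in_filled_julia_iff[OF R]
        filterlim_sequentially_Suc[of "\<lambda>n. seq_iter \<omega> n w"] by blast
    then show False
      using normal_family_range_imp_not_escaping[OF U(3,2) w(1)] \<open>z \<in> filled_julia \<omega>\<close>
      unfolding filled_julia_iff_bounded_Suc by blast
  qed
qed

lemma julia_eq_frontier_filled_julia: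
  assumes R: "escape_radius R \<omega>"
  shows "julia \<omega> = frontier (filled_julia \<omega>)"
proof -
  have "frontier (filled_julia \<omega>) = filled_julia \<omega> - interior (filled_julia \<omega>)"
    using compact_imp_closed[OF compact_filled_julia[OF R]] by (simp add: frontier_def)
  then show ?thesis
    using julia_subset_filled_julia[OF R] julia_Int_interior_filled_julia[OF R]
      frontier_filled_julia_subset_julia[OF R] by blast
qed

lemma obtain_norm_add_eq:
  fixes x :: "'a::{real_normed_vector, perfect_space}"
  assumes "0 \<le> t"
  obtains v where "norm v = t" "norm (x + v) = norm x + t"
proof (cases "x = 0")
  case True
  then show ?thesis using vector_choose_size[OF assms] that by auto
next
  case False
  have "x + t *\<^sub>R sgn x = (norm x + t) *\<^sub>R sgn x"
    using False by (simp add: sgn_div_norm distrib_right scaleR_left_distrib)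
  then have "norm (x + t *\<^sub>R sgn x) = norm x + t"
    using False assms by (simp add: norm_sgn)
  then show ?thesis using that[of "t *\<^sub>R sgn x"] False assms by (simp add: norm_sgn)
qed

lemma julia_two_points:
  assumes R: "escape_radius R \<omega>"
  shows "\<exists>x\<in>julia \<omega>. \<exists>y\<in>julia \<omega>. x \<noteq> y"
proof -
  let ?K = "filled_julia \<omega>"
  obtain w where w: "w \<in> ?K" "1 \<le> cmod w" using filled_julia_large_point[OF R] by blast
  then obtain z where z: "z \<in> ?K" "\<And>y. y \<in> ?K \<Longrightarrow> cmod y \<le> cmod z"
    using continuous_attains_sup[OF compact_filled_julia[OF R], of cmod] continuous_on_norm_id
    by blast
  have "z \<noteq> 0" using z(2)[OF w(1)] w(2) by auto
  have extremal: "x \<in> frontier ?K" if x: "x \<in> ?K" "cmod x = cmod z" for x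
  proof -
    have "x \<notin> interior ?K"
    proof
      assume "x \<in> interior ?K"
      then obtain e where e: "e > 0" "cball x e \<subseteq> ?K" unfolding mem_interior_cball by blast
      obtain v where v: "cmod v = e" "cmod (x + v) = cmod x + e"
        using obtain_norm_add_eq[of e x] e(1) by auto
      then have "x + v \<in> ?K" using e(2) by (auto simp: dist_norm)
      then show False using z(2)[of "x + v"] v(2) x(2) e(1) by simp
    qed
    then show ?thesis using x(1) closure_subset by (auto simp: frontier_def)
  qed
  have "z \<in> julia \<omega>" "- z \<in> julia \<omega>"
    unfolding julia_eq_frontier_filled_julia[OF R] using z(1)
    by (auto intro!: extremal simp: filled_julia_uminus)
  moreover have "z \<noteq> - z" using \<open>z \<noteq> 0\<close> by simp
  ultimately show ?thesis by blast
qed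

subsection \<open>Connected Julia sets\<close>

lemma surj_fq: "surj (fq c)"
  by (rule surjI[of _ "\<lambda>w. csqrt (w - c)"]) (simp add: fq_def)

lemma compact_vimage_fq:
  assumes "compact E"
  shows "compact (fq c -` E)"
proof -
  obtain M where M: "\<And>w. w \<in> E \<Longrightarrow> cmod w \<le> M"
    using compact_imp_bounded[OF assms] unfolding bounded_iff by blast
  have "cmod z \<le> sqrt (M + cmod c)" if "z \<in> fq c -` E" for z
  proof (rule real_le_rsqrt)
    have "cmod (z^2) \<le> cmod (fq c z) + cmod c"
      unfolding fq_def using norm_triangle_ineq4[of "z^2 + c" c] by simp
    then show "cmod z ^ 2 \<le> M + cmod c" using M[of "fq c z"] that by (simp add: norm_power)
  qed
  moreover have "closed (fq c -` E)"
    unfolding fq_def by (intro closed_vimage compact_imp_closed[OF assms] continuous_intros)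
  ultimately show ?thesis unfolding compact_eq_bounded_closed bounded_iff by blast
qed

lemma fq_image_disjoint:
  assumes "uminus ` A = A" "A \<inter> B = {}"
  shows "fq c ` A \<inter> fq c ` B = {}"
proof (rule equals0I)
  fix w assume "w \<in> fq c ` A \<inter> fq c ` B"
  then obtain x y where xy: "x \<in> A" "y \<in> B" "fq c x = fq c y" by auto
  then have "y = x \<or> y = - x" by (auto simp: fq_def power2_eq_iff)
  then have "y \<in> A" using xy(1) assms(1) by blast
  then show False using xy(2) assms(2) by blast
qed

lemma connected_vimage_fq:
  assumes E: "compact E" "connected E" "c \<in> E"
  shows "connected (fq c -` E)"
proof -
  let ?S = "fq c -` E"
  have S: "compact ?S" by (rule compact_vimage_fq[OF E(1)])
  have no_split: "B = {}" if AB: "closed A" "closed B" "A \<union> B = ?S" "A \<inter> B = {}" "0 \<in> A" for A B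
  proof -
    define A' where "A' = A \<inter> uminus ` A"
    define B' where "B' = B \<union> uminus ` B"
    have mem_uminus: "z \<in> uminus ` X \<longleftrightarrow> - z \<in> X" for z and X :: "complex set"
      by (metis image_iff minus_minus)
    have "- z \<in> ?S \<longleftrightarrow> z \<in> ?S" for z by (simp add: fq_uminus)
    then have cover: "A' \<union> B' = ?S" and disjoint: "A' \<inter> B' = {}"
      using AB(3,4) unfolding A'_def B'_def set_eq_iff Un_iff Int_iff mem_uminus by blast+
    have "A = ?S \<inter> A" "B = ?S \<inter> B" using AB(3) by blast+
    then have "compact A" "compact B" using compact_Int_closed[OF S] AB(1,2) by metis+
    then have "compact A'" "compact B'"
      unfolding A'_def B'_def
      by (auto intro!: compact_Int compact_Un compact_continuous_image continuous_intros)
    then have "closed (fq c ` A')" "closed (fq c ` B')"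
      unfolding fq_def
      by (auto intro!: compact_imp_closed compact_continuous_image continuous_intros)
    moreover have "fq c ` A' \<union> fq c ` B' = E"
      using cover surj_fq[of c] by (metis image_Un surj_image_vimage_eq)
    moreover have "fq c ` A' \<inter> fq c ` B' = {}"
      using disjoint by (intro fq_image_disjoint) (auto simp: A'_def mem_uminus image_Int)
    moreover have "A' \<noteq> {}" using AB(5) by (auto simp: A'_def mem_uminus)
    ultimately have "B' = {}"
      using E(2) connected_closed_set[OF compact_imp_closed[OF E(1)]] by (metis image_is_empty)
    then show "B = {}" by (simp add: B'_def)
  qed
  have "0 \<in> ?S" using E(3) by (simp add: fq_def)
  then show ?thesis
    unfolding connected_closed_set[OF compact_imp_closed[OF S]]
    using no_split by (metis Int_commute Un_commute Un_iff)
qed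

lemma connected_seq_iter_le:
  assumes "escape_radius R \<omega>"
    and "\<And>m. m < n \<Longrightarrow> cmod (seq_iter (shift_seq m \<omega>) (n - m) 0) \<le> R"
  shows "connected {z. cmod (seq_iter \<omega> n z) \<le> R}"
  using assms
proof (induction n arbitrary: \<omega>)
  case 0
  have "{z. cmod (seq_iter \<omega> 0 z) \<le> R} = cball 0 R" by auto
  then show ?case by simp
next
  case (Suc n)
  let ?E = "{z. cmod (seq_iter (shift_seq 1 \<omega>) n z) \<le> R}"
  have "connected (fq (\<omega> 0) -` ?E)"
  proof (rule connected_vimage_fq)
    show "compact ?E" using Suc.prems(1) by (intro compact_seq_iter_le) simp
    show "connected ?E"
    proof (rule Suc.IH)
      show "cmod (seq_iter (shift_seq m (shift_seq 1 \<omega>)) (n - m) 0) \<le> R" if "m < n" for m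
        using Suc.prems(2)[of "Suc m"] that by simp
    qed (use Suc.prems in simp)
    have "cmod (seq_iter \<omega> (Suc n) 0) \<le> R" using Suc.prems(2)[of 0] by simp
    then show "\<omega> 0 \<in> ?E" by (simp only: seq_iter_Suc_shift) (simp add: fq_def)
  qed
  then show ?case by (simp only: seq_iter_Suc_shift vimage_Collect_eq)
qed

lemma connected_filled_julia:
  assumes R: "escape_radius R \<omega>" and critical: "\<And>m. 0 \<in> filled_julia (shift_seq m \<omega>)"
  shows "connected (filled_julia \<omega>)"
  unfolding filled_julia_eq_INT[OF R]
proof (rule connected_nest)
  show "compact {z. cmod (seq_iter \<omega> n z) \<le> R}" for n by (rule compact_seq_iter_le[OF R])
  have "cmod (seq_iter (shift_seq m \<omega>) n 0) \<le> R" for m n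
    using critical filled_julia_iff[OF escape_radius_shift_seq[OF R]] by blast
  then show "connected {z. cmod (seq_iter \<omega> n z) \<le> R}" for n
    by (intro connected_seq_iter_le[OF R])
  show "{z. cmod (seq_iter \<omega> n z) \<le> R} \<subseteq> {z. cmod (seq_iter \<omega> m z) \<le> R}" if "m \<le> n" for m n
    using norm_seq_iter_le_antimono[OF R _ that] by blast
qed

lemma norm_le_on_inside:
  assumes "F holomorphic_on UNIV" "compact S" "\<And>z. z \<in> S \<Longrightarrow> cmod (F z) \<le> B" "z \<in> inside S"
  shows "cmod (F z) \<le> B"
proof (rule maximum_modulus_frontier[where f = F and S = "inside S" and \<xi> = z])
  show "F holomorphic_on interior (inside S)" "continuous_on (closure (inside S)) F"
    using assms(1) holomorphic_on_subset holomorphic_on_imp_continuous_on by blast+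
  show "bounded (inside S)" by (rule bounded_inside[OF compact_imp_bounded[OF assms(2)]])
  show "cmod (F w) \<le> B" if "w \<in> frontier (inside S)" for w
    using that frontier_inside_subset[OF compact_imp_closed[OF assms(2)]] assms(3) by blast
qed (rule assms(4))

lemma connected_Compl_filled_julia:
  assumes R: "escape_radius R \<omega>"
  shows "connected (- filled_julia \<omega>)"
proof -
  let ?K = "filled_julia \<omega>"
  have "inside ?K \<subseteq> ?K"
  proof
    fix z assume "z \<in> inside ?K"
    then have "cmod (seq_iter \<omega> n z) \<le> R" for n
      by (rule norm_le_on_inside[OF _ compact_filled_julia[OF R], rotated 2])
        (auto intro: holomorphic_intros simp: filled_julia_iff[OF R])
    then show "z \<in> ?K" by (simp add: filled_julia_iff[OF R])
  qed
  then have "inside ?K = {}" using inside_no_overlap[of ?K] by blast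
  then have "- ?K = outside ?K" using inside_Un_outside[of ?K] by simp
  then show ?thesis
    using connected_outside[OF compact_imp_bounded[OF compact_filled_julia[OF R]]] by simp
qed

lemma connected_julia:
  assumes "escape_radius R \<omega>" "\<And>m. 0 \<in> filled_julia (shift_seq m \<omega>)"
  shows "connected (julia \<omega>)"
  unfolding julia_eq_frontier_filled_julia[OF assms(1)]
  by (intro connected_frontier_simple connected_filled_julia[OF assms]
      connected_Compl_filled_julia[OF assms(1)])

lemma connected_imp_not_totally_disconnected:
  assumes "connected S" "x \<in> S" "y \<in> S" "x \<noteq> y"
  shows "\<not> totally_disconnected S"
proof
  assume "totally_disconnected S"
  then have "connected_component_set S x = {x}"
    using assms(2) by (simp add: totally_disconnected_def)
  moreover have "connected_component_set S x = S"
    using assms(1,2) connected_iff_eq_connected_component_set by blast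
  ultimately show False using assms(3,4) by auto
qed

lemma connected_julia_imp_not_totally_disconnected:
  assumes "escape_radius R \<omega>" "connected (julia \<omega>)"
  shows "\<not> totally_disconnected (julia \<omega>)"
  using julia_two_points[OF assms(1)] connected_imp_not_totally_disconnected[OF assms(2)] by blast

subsection \<open>Totally disconnected Julia sets\<close>

lemma simply_connected_component_norm_less:
  assumes F: "F holomorphic_on UNIV"
  shows "simply_connected (connected_component_set {z. cmod (F z) < t} w)"
    (is "simply_connected ?U")
proof -
  let ?S = "{z. cmod (F z) < t}"
  have cont: "continuous_on A F" for A
    using F holomorphic_on_imp_continuous_on continuous_on_subset by blast
  have "open ?U"
    by (intro open_connected_component open_Collect_less continuous_intros cont)
  have "winding_number p z = 0"
    if p: "path p" "path_image p \<subseteq> ?U" "pathfinish p = pathstart p" and z: "z \<notin> ?U" for p z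
  proof -
    let ?T = "path_image p"
    have compact_T: "compact ?T" using p(1) by (rule compact_path_image)
    have "continuous_on ?T (\<lambda>s. cmod (F s))" by (intro continuous_intros cont)
    then obtain s where s: "s \<in> ?T" "\<And>q. q \<in> ?T \<Longrightarrow> cmod (F q) \<le> cmod (F s)"
      using continuous_attains_sup[OF compact_T path_image_nonempty] by blast
    have "?T \<union> inside ?T \<subseteq> connected_component_set ?S s"
    proof (rule connected_component_maximal)
      show "connected (?T \<union> inside ?T)"
        by (rule connected_with_inside)
          (use p(1) compact_imp_closed[OF compact_T] in \<open>auto simp: connected_path_image\<close>)
      have "cmod (F s) < t" using s(1) p(2) connected_component_subset by blast
      moreover have "cmod (F q) \<le> cmod (F s)" if "q \<in> ?T \<union> inside ?T" for q
        using that s(2) norm_le_on_inside[OF F compact_T s(2)] by blast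
      ultimately show "?T \<union> inside ?T \<subseteq> ?S" by force
    qed (use s(1) in blast)
    also have "connected_component_set ?S s = ?U"
      using s(1) p(2) connected_component_eq by blast
    finally have "z \<in> outside ?T" using z inside_Un_outside[of ?T] by blast
    then show ?thesis by (intro winding_number_zero_in_outside p)
  qed
  then show ?thesis
    using simply_connected_eq_winding_number_zero[OF \<open>open ?U\<close>] connected_connected_component
    by blast
qed

lemma sublevel_component_captures_subsequence:
  fixes X :: "nat \<Rightarrow> complex set"
  assumes G: "G holomorphic_on UNIV" and "s < t" and bounded: "bounded {z. cmod (G z) \<le> s}"
    and X: "\<And>n. connected (X n)" "\<And>n. X n \<noteq> {}" "\<And>n. X n \<subseteq> {z. cmod (G z) \<le> s}"
  obtains U Q \<sigma> where "open U" "simply_connected U" "U \<subseteq> {z. cmod (G z) < t}"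
    "compact Q" "Q \<subseteq> U" "strict_mono (\<sigma> :: nat \<Rightarrow> nat)" "\<And>n. X (\<sigma> n) \<subseteq> Q"
proof -
  let ?S = "{z. cmod (G z) < t}" and ?Q = "{z. cmod (G z) \<le> s}"
  have cont: "continuous_on A G" for A
    using G holomorphic_on_imp_continuous_on continuous_on_subset by blast
  have "open ?S" by (intro open_Collect_less continuous_intros cont)
  have "closed ?Q" by (intro closed_Collect_le continuous_intros cont)
  then have compact_Q: "compact ?Q" using bounded compact_eq_bounded_closed by blast
  have Q_S: "?Q \<subseteq> ?S" using \<open>s < t\<close> by auto
  obtain x where x: "\<And>n. x n \<in> X n" using X(2) unfolding ex_in_conv[symmetric] by metis
  obtain w \<tau> where w: "w \<in> ?Q" and \<tau>: "strict_mono (\<tau> :: nat \<Rightarrow> nat)" "(x \<circ> \<tau>) \<longlonglongrightarrow> w"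
    using compact_Q[unfolded compact_def, rule_format, of x] x X(3) by blast
  define U where "U = connected_component_set ?S w"
  have "open U" unfolding U_def by (rule open_connected_component[OF \<open>open ?S\<close>])
  moreover have "w \<in> U" using w Q_S unfolding U_def by auto
  ultimately obtain N where N: "\<And>n. N \<le> n \<Longrightarrow> x (\<tau> n) \<in> U"
    using topological_tendstoD[OF \<tau>(2)] unfolding eventually_sequentially o_def by blast
  show ?thesis
  proof (rule that[of U "?Q \<inter> U" "\<lambda>n. \<tau> (n + N)"])
    show "simply_connected U" unfolding U_def by (rule simply_connected_component_norm_less[OF G])
    show "U \<subseteq> ?S" unfolding U_def by (rule connected_component_subset)
    obtain A where "closed A" "U = ?S \<inter> A"
      using closedin_connected_component[of ?S w] unfolding U_def closedin_closed by blast
    then have "?Q \<inter> U = ?Q \<inter> A" using Q_S by blast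
    then show "compact (?Q \<inter> U)" using compact_Q \<open>closed A\<close> by (simp add: compact_Int_closed)
    show "strict_mono (\<lambda>n. \<tau> (n + N))" using \<tau>(1) by (auto simp: strict_mono_def)
    show "X (\<tau> (n + N)) \<subseteq> ?Q \<inter> U" for n
    proof -
      have "X (\<tau> (n + N)) \<subseteq> connected_component_set ?S (x (\<tau> (n + N)))"
        by (intro connected_component_maximal x X(1) order_trans[OF X(3) Q_S])
      also have "\<dots> = U" using N[of "n + N"] unfolding U_def by (intro connected_component_eq) simp
      finally show ?thesis using X(3) by blast
    qed
  qed (use \<open>open U\<close> in auto)
qed

lemma common_sublevel_component:
  fixes F :: "nat \<Rightarrow> complex \<Rightarrow> complex" and X :: "nat \<Rightarrow> complex set"
  assumes F: "\<And>n. F n holomorphic_on UNIV"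
    and F_bounded: "\<And>K. compact K \<Longrightarrow> \<exists>B. \<forall>n. \<forall>z\<in>K. cmod (F n z) \<le> B"
    and outer: "\<And>n z. \<rho> \<le> cmod z \<Longrightarrow> b \<le> cmod (F n z)" and "a < b"
    and X: "\<And>n. connected (X n)" "\<And>n. X n \<noteq> {}" "\<And>n z. z \<in> X n \<Longrightarrow> cmod (F n z) \<le> a"
  obtains U Q \<sigma> where "open U" "simply_connected U" "U \<subseteq> ball 0 \<rho>" "compact Q" "Q \<subseteq> U"
    "strict_mono (\<sigma> :: nat \<Rightarrow> nat)" "\<And>n. X (\<sigma> n) \<subseteq> Q" "\<And>n u. u \<in> U \<Longrightarrow> cmod (F (\<sigma> n) u) < b"
proof -
  define e where "e = (b - a) / 3"
  have e: "e > 0" "b = a + 3 * e" using \<open>a < b\<close> by (simp_all add: e_def field_simps)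
  obtain G \<sigma> where G: "G holomorphic_on UNIV" and \<sigma>: "strict_mono (\<sigma> :: nat \<Rightarrow> nat)"
    and pointwise: "\<And>z. (\<lambda>n. F (\<sigma> n) z) \<longlonglongrightarrow> G z"
    and uniform: "\<And>K. compact K \<Longrightarrow> uniform_limit K (F \<circ> \<sigma>) G sequentially"
    by (rule Montel[of UNIV "range F" F]) (use F F_bounded in auto)
  have "b \<le> cmod (G z)" if "\<rho> \<le> cmod z" for z
    by (rule tendsto_lowerbound[OF tendsto_norm[OF pointwise]]) (use outer that in auto)
  then have sublevel: "cmod z < \<rho>" if "cmod (G z) < b" for z using that by (meson not_less)
  obtain N where N: "\<And>n z. N \<le> n \<Longrightarrow> cmod z \<le> \<rho> \<Longrightarrow> dist (F (\<sigma> n) z) (G z) < e"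
    using uniform_limitD[OF uniform[OF compact_cball] \<open>e > 0\<close>, of 0 \<rho>]
    unfolding eventually_sequentially o_def by (metis mem_cball_0)
  have close: "\<bar>cmod (F (\<sigma> (n + N)) z) - cmod (G z)\<bar> < e" if "cmod z \<le> \<rho>" for n z
    using N[OF _ that, of "n + N"] norm_triangle_ineq3[of "F (\<sigma> (n + N)) z" "G z"]
    by (simp add: dist_norm)
  obtain U Q \<tau> where U: "open U" "simply_connected U" "U \<subseteq> {z. cmod (G z) < a + 2 * e}"
    and Q: "compact Q" "Q \<subseteq> U" "\<And>n. X (\<sigma> (\<tau> n + N)) \<subseteq> Q" and \<tau>: "strict_mono (\<tau> :: nat \<Rightarrow> nat)"
  proof (rule sublevel_component_captures_subsequence[OF G,
        of "a + e" "a + 2 * e" "\<lambda>n. X (\<sigma> (n + N))"])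
    show "bounded {z. cmod (G z) \<le> a + e}"
      by (rule bounded_subset[OF bounded_ball[of 0 \<rho>]]) (use sublevel e in auto)
    show "X (\<sigma> (n + N)) \<subseteq> {z. cmod (G z) \<le> a + e}" for n
    proof safe
      fix z assume "z \<in> X (\<sigma> (n + N))"
      then have "cmod (F (\<sigma> (n + N)) z) \<le> a" by (rule X(3))
      moreover from this have "cmod z \<le> \<rho>"
        using outer \<open>a < b\<close> by (meson le_less_trans linear not_le)
      ultimately show "cmod (G z) \<le> a + e" using close[of z n] by simp
    qed
  qed (use X e in auto)
  show ?thesis
  proof (rule that[of U Q "\<lambda>n. \<sigma> (\<tau> n + N)"])
    have small: "cmod z < \<rho>" if "z \<in> U" for z using that U(3) e by (intro sublevel) auto
    then show "U \<subseteq> ball 0 \<rho>" by auto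
    show "strict_mono (\<lambda>n. \<sigma> (\<tau> n + N))" using \<sigma> \<tau> by (auto simp: strict_mono_def)
    show "cmod (F (\<sigma> (\<tau> n + N)) u) < b" if "u \<in> U" for n u
      using close[of u "\<tau> n"] small[OF that] that U(3) e(2) by auto
  qed (use U Q in auto)
qed

lemma limit_of_survivors_in_filled_julia:
  assumes R: "escape_radius R \<omega>" and k: "filterlim k at_top sequentially" and y: "y \<longlonglongrightarrow> z"
    and survives: "\<And>n. cmod (seq_iter \<omega> (k n) (y n)) \<le> R"
  shows "z \<in> filled_julia \<omega>"
  unfolding filled_julia_iff[OF R]
proof
  fix m
  have "continuous_on UNIV (seq_iter \<omega> m)" by (intro continuous_intros)
  then have "(\<lambda>n. seq_iter \<omega> m (y n)) \<longlonglongrightarrow> seq_iter \<omega> m z"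
    by (rule continuous_on_tendsto_compose[OF _ y]) auto
  moreover have "\<forall>\<^sub>F n in sequentially. m \<le> k n" using k by (simp add: filterlim_at_top)
  then have "\<forall>\<^sub>F n in sequentially. cmod (seq_iter \<omega> m (y n)) \<le> R"
    by eventually_elim (rule norm_seq_iter_le_antimono[OF R survives])
  ultimately show "cmod (seq_iter \<omega> m z) \<le> R"
    by (intro tendsto_upperbound[OF tendsto_norm]) auto
qed

lemma uniform_limit_image_compact:
  fixes f :: "nat \<Rightarrow> 'a::topological_space \<Rightarrow> 'b::metric_space"
  assumes "compact Q" and lim: "uniform_limit Q f g sequentially" and "continuous_on Q g"
    and v: "\<And>n. v \<in> f n ` Q"
  shows "v \<in> g ` Q"
proof -
  have "closed (g ` Q)" by (intro compact_imp_closed compact_continuous_image assms)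
  moreover have "v \<in> closure (g ` Q)"
    unfolding closure_approachable
  proof (intro allI impI)
    fix e :: real assume "e > 0"
    then obtain n where n: "\<forall>u\<in>Q. dist (f n u) (g u) < e"
      using eventually_happens'[OF sequentially_bot uniform_limitD[OF lim]] by blast
    obtain u where "u \<in> Q" "v = f n u" using v by blast
    then show "\<exists>y\<in>g ` Q. dist y v < e" using n by (auto simp: dist_commute)
  qed
  ultimately show ?thesis by (simp add: closure_closed)
qed

text \<open>A limit of the inverse branches maps \<open>U\<close> into the filled Julia set, so it is constant by
  the open mapping theorem. But its values on \<open>Q\<close> include all of \<open>C\<close>.\<close>

lemma univalent_pullbacks_imp_trivial:
  assumes R: "escape_radius R \<omega>" and int: "interior (filled_julia \<omega>) = {}"
    and U: "open U" "simply_connected U" "U \<subseteq> ball 0 R" and Q: "compact Q" "Q \<subseteq> U"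
    and k: "strict_mono (k :: nat \<Rightarrow> nat)" and C: "connected C" "\<And>n. seq_iter \<omega> (k n) ` C \<subseteq> Q"
    and critical: "\<And>n m. m < k n \<Longrightarrow> seq_iter (shift_seq m \<omega>) (k n - m) 0 \<notin> U"
    and xy: "x \<in> C" "y \<in> C"
  shows "x = y"
proof (rule ccontr)
  assume "x \<noteq> y"
  have "\<exists>h. h holomorphic_on U \<and> (\<forall>u\<in>U. seq_iter \<omega> (k n) (h u) = u) \<and>
      (\<forall>v\<in>C. h (seq_iter \<omega> (k n) v) = v)" for n
    using C(2) Q(2) by (intro inverse_branch U C(1) critical) blast+
  then obtain h where h: "\<And>n. h n holomorphic_on U" "\<And>n u. u \<in> U \<Longrightarrow> seq_iter \<omega> (k n) (h n u) = u"
    and h_inverse: "\<And>n v. v \<in> C \<Longrightarrow> h n (seq_iter \<omega> (k n) v) = v" by metis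
  have survives: "cmod (seq_iter \<omega> (k n) (h n u)) \<le> R" if "u \<in> U" for n u
    using h(2)[OF that] U(3) that by auto
  obtain H \<rho> where H: "H holomorphic_on U" and \<rho>: "strict_mono (\<rho> :: nat \<Rightarrow> nat)"
    and pointwise: "\<And>u. u \<in> U \<Longrightarrow> (\<lambda>n. h (\<rho> n) u) \<longlonglongrightarrow> H u"
    and uniform: "\<And>K. compact K \<Longrightarrow> K \<subseteq> U \<Longrightarrow> uniform_limit K (h \<circ> \<rho>) H sequentially"
  proof (rule Montel[of U "range h" h])
    have "cmod (h n u) \<le> R" if "u \<in> U" for n u
      using norm_seq_iter_le_antimono[OF R survives[OF that], of 0] by simp
    then show "\<exists>B. \<forall>f\<in>range h. \<forall>z\<in>K. cmod (f z) \<le> B" if "K \<subseteq> U" for K using that by blast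
  qed (use U h in auto)
  have "filterlim (\<lambda>n. k (\<rho> n)) at_top sequentially"
    using k \<rho> by (intro filterlim_subseq) (auto simp: strict_mono_def)
  then have "H u \<in> filled_julia \<omega>" if "u \<in> U" for u
    by (rule limit_of_survivors_in_filled_julia[OF R _ pointwise[OF that] survives[OF that]])
  moreover have "v \<in> H ` Q" if v: "v \<in> C" for v
  proof (rule uniform_limit_image_compact[OF Q(1) uniform[OF Q]])
    show "continuous_on Q H"
      using H Q(2) holomorphic_on_imp_continuous_on continuous_on_subset by blast
    show "v \<in> (h \<circ> \<rho>) n ` Q" for n
    proof
      show "v = (h \<circ> \<rho>) n (seq_iter \<omega> (k (\<rho> n)) v)" by (simp add: h_inverse[OF v])
      show "seq_iter \<omega> (k (\<rho> n)) v \<in> Q" using C(2) v by blast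
    qed
  qed
  then have "\<not> H constant_on U"
    using xy \<open>x \<noteq> y\<close> Q(2) unfolding constant_on_def by (metis imageE subsetD)
  then have "open (H ` U)"
    by (intro open_mapping_thm[OF H U(1) simply_connected_imp_connected[OF U(2)] U(1)]) auto
  ultimately have "H ` U \<subseteq> interior (filled_julia \<omega>)" by (intro interior_maximal) auto
  then show False using int xy(1) C(2)[of 0] Q(2) by auto
qed

lemma seq_iter_uniformly_bounded:
  assumes "bounded K"
  shows "\<exists>B. \<forall>\<omega>. escape_radius R \<omega> \<longrightarrow> (\<forall>z\<in>K. cmod (seq_iter \<omega> n z) \<le> B)"
proof (induction n)
  case 0
  then show ?case using assms by (simp add: bounded_iff)
next
  case (Suc n)
  then obtain B where B: "\<And>\<omega> z. escape_radius R \<omega> \<Longrightarrow> z \<in> K \<Longrightarrow> cmod (seq_iter \<omega> n z) \<le> B"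
    by blast
  have "cmod (seq_iter \<omega> (Suc n) z) \<le> B\<^sup>2 + R" if \<omega>: "escape_radius R \<omega>" and z: "z \<in> K" for \<omega> z
  proof -
    have "cmod (seq_iter \<omega> (Suc n) z) \<le> cmod (seq_iter \<omega> n z) ^ 2 + cmod (\<omega> n)"
      by (simp add: fq_def norm_triangle_le norm_power)
    also have "\<dots> \<le> B\<^sup>2 + R"
      using B[OF \<omega> z] spec[OF \<omega>[unfolded escape_radius_def], of n]
      by (intro add_mono power_mono) auto
    finally show ?thesis .
  qed
  then show ?case by blast
qed

definition critical_points_escape :: "real \<Rightarrow> (nat \<Rightarrow> complex) \<Rightarrow> nat \<Rightarrow> nat \<Rightarrow> bool" where
  "critical_points_escape R \<omega> m k \<longleftrightarrow>
    (\<forall>j<k. R < cmod (seq_iter (shift_seq j \<omega>) (k + m - j) 0))"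

lemma critical_points_escape_imp_ge_double:
  assumes R: "escape_radius R \<omega>" and escape: "critical_points_escape R \<omega> m k" and "j < k"
  shows "2 * R \<le> cmod (seq_iter (shift_seq k \<omega>) (Suc m) (seq_iter (shift_seq j \<omega>) (k - j) 0))"
proof -
  have "R < cmod (seq_iter (shift_seq j \<omega>) (k + m - j) 0)"
    using escape \<open>j < k\<close> by (simp add: critical_points_escape_def)
  then have "2 * R \<le> cmod (seq_iter (shift_seq j \<omega>) (k + m - j + 1) 0)"
    using norm_seq_iter_add_ge[OF escape_radius_shift_seq[OF R], of j _ 0 1] by simp
  also have "k + m - j + 1 = k - j + Suc m" using \<open>j < k\<close> by simp
  finally show ?thesis using \<open>j < k\<close> by (simp only: seq_iter_add) simp
qed

lemma connected_subset_filled_julia_trivial: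
  assumes R: "escape_radius R \<omega>" and int: "interior (filled_julia \<omega>) = {}"
    and escape: "\<exists>\<^sub>\<infinity>k. critical_points_escape R \<omega> m k"
    and C: "connected C" "C \<subseteq> filled_julia \<omega>" "x \<in> C" "y \<in> C"
  shows "x = y"
proof -
  define k where "k = enumerate {k. critical_points_escape R \<omega> m k}"
  have "infinite {k. critical_points_escape R \<omega> m k}"
    using escape by (simp add: frequently_cofinite)
  then have k: "strict_mono k" "\<And>n. critical_points_escape R \<omega> m (k n)"
    unfolding k_def using enumerate_in_set by (auto simp: strict_mono_enumerate)
  define F where "F n = seq_iter (shift_seq (k n) \<omega>) (Suc m)" for n
  obtain U Q \<sigma> where U: "open U" "simply_connected U" "U \<subseteq> ball 0 R" "compact Q" "Q \<subseteq> U"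
    and \<sigma>: "strict_mono (\<sigma> :: nat \<Rightarrow> nat)" "\<And>n. seq_iter \<omega> (k (\<sigma> n)) ` C \<subseteq> Q"
    and F_less: "\<And>n u. u \<in> U \<Longrightarrow> cmod (F (\<sigma> n) u) < 2 * R"
  proof (rule common_sublevel_component[of F R "2 * R" R "\<lambda>n. seq_iter \<omega> (k n) ` C"])
    show "F n holomorphic_on UNIV" for n unfolding F_def by (intro holomorphic_intros)
    show "\<exists>B. \<forall>n. \<forall>z\<in>K. cmod (F n z) \<le> B" if "compact K" for K
      using seq_iter_uniformly_bounded[OF compact_imp_bounded[OF \<open>compact K\<close>]]
        escape_radius_shift_seq[OF R] unfolding F_def by meson
    show "2 * R \<le> cmod (F n z)" if "R \<le> cmod z" for n z
      unfolding F_def by (rule norm_seq_iter_Suc_ge_double[OF escape_radius_shift_seq[OF R] that])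
    show "connected (seq_iter \<omega> (k n) ` C)" for n
      by (intro connected_continuous_image continuous_intros C)
    show "cmod (F n z) \<le> R" if "z \<in> seq_iter \<omega> (k n) ` C" for n z
      using that
    proof
      fix v assume "v \<in> C" "z = seq_iter \<omega> (k n) v"
      then have "F n z = seq_iter \<omega> (k n + Suc m) v" unfolding F_def by (simp only: seq_iter_add)
      then show ?thesis using C(2) \<open>v \<in> C\<close> filled_julia_iff[OF R] by (metis subsetD)
    qed
  qed (use escape_radius_ge_2[OF R] C(3) in auto)
  show ?thesis
  proof (rule univalent_pullbacks_imp_trivial[OF R int U _ C(1) \<sigma>(2) _ C(3,4)])
    show "strict_mono (\<lambda>n. k (\<sigma> n))" using k(1) \<sigma>(1) by (auto simp: strict_mono_def)
    show "seq_iter (shift_seq j \<omega>) (k (\<sigma> n) - j) 0 \<notin> U" if "j < k (\<sigma> n)" for n j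
      using F_less critical_points_escape_imp_ge_double[OF R k(2) that]
      unfolding F_def by (meson not_le)
  qed
qed

lemma julia_totally_disconnected:
  assumes R: "escape_radius R \<omega>" and int: "interior (filled_julia \<omega>) = {}"
    and escape: "\<exists>\<^sub>\<infinity>k. critical_points_escape R \<omega> m k"
  shows "totally_disconnected (julia \<omega>)"
  unfolding totally_disconnected_def
proof
  fix x assume x: "x \<in> julia \<omega>"
  have "y = x" if "y \<in> connected_component_set (julia \<omega>) x" for y
    by (rule connected_subset_filled_julia_trivial[OF R int escape
        connected_connected_component _ that])
      (use x connected_component_subset julia_subset_filled_julia[OF R] in \<open>blast | simp\<close>)+
  then show "connected_component_set (julia \<omega>) x = {x}" using x by auto
qed

subsection \<open>Escape probabilities\<close>

definition measure_support :: "'a::metric_space measure \<Rightarrow> 'a set" where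
  "measure_support M = {x. \<forall>\<delta>>0. emeasure M (ball x \<delta>) > 0}"

lemma seq_iter_close:
  assumes "\<epsilon> > 0"
  shows "\<exists>\<delta>>0. \<forall>\<omega>' w. (\<forall>i<n. dist (\<omega>' i) (\<omega> i) < \<delta>) \<longrightarrow> dist w z < \<delta> \<longrightarrow>
    dist (seq_iter \<omega>' n w) (seq_iter \<omega> n z) < \<epsilon>"
  using assms
proof (induction n arbitrary: \<epsilon>)
  case 0
  then show ?case by auto
next
  case (Suc n)
  have "isCont (\<lambda>x::complex. x^2) (seq_iter \<omega> n z)" by (intro continuous_intros)
  then obtain \<gamma> where \<gamma>: "\<gamma> > 0"
      "\<And>x. dist x (seq_iter \<omega> n z) < \<gamma> \<Longrightarrow> dist (x^2) (seq_iter \<omega> n z ^ 2) < \<epsilon> / 2"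
    unfolding continuous_at_eps_delta using Suc.prems half_gt_zero by blast
  obtain \<delta> where \<delta>: "\<delta> > 0" "\<And>\<omega>' w. \<forall>i<n. dist (\<omega>' i) (\<omega> i) < \<delta> \<Longrightarrow> dist w z < \<delta> \<Longrightarrow>
      dist (seq_iter \<omega>' n w) (seq_iter \<omega> n z) < \<gamma>"
    using Suc.IH[OF \<gamma>(1)] by blast
  show ?case
  proof (intro exI[of _ "min \<delta> (\<epsilon> / 2)"] conjI allI impI)
    fix \<omega>' w assume near: "\<forall>i<Suc n. dist (\<omega>' i) (\<omega> i) < min \<delta> (\<epsilon> / 2)" "dist w z < min \<delta> (\<epsilon> / 2)"
    have "dist (seq_iter \<omega>' (Suc n) w) (seq_iter \<omega> (Suc n) z)
        \<le> dist (seq_iter \<omega>' n w ^ 2) (seq_iter \<omega> n z ^ 2) + dist (\<omega>' n) (\<omega> n)"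
      by (simp add: fq_def dist_triangle_add)
    also have "\<dots> < \<epsilon> / 2 + \<epsilon> / 2" using near by (intro add_strict_mono \<gamma>(2) \<delta>(2)) auto
    finally show "dist (seq_iter \<omega>' (Suc n) w) (seq_iter \<omega> (Suc n) z) < \<epsilon>" by simp
  qed (use \<delta>(1) Suc.prems in simp)
qed

lemma emeasure_eventually_le:
  assumes [measurable]: "\<And>k. Measurable.pred M (P k)"
    and le: "\<And>k. emeasure M {x \<in> space M. P k x} \<le> a"
  shows "emeasure M {x \<in> space M. \<forall>\<^sub>F k in sequentially. P k x} \<le> a"
proof -
  let ?A = "\<lambda>m. {x \<in> space M. \<forall>k\<ge>m. P k x}"
  have "{x \<in> space M. \<forall>\<^sub>F k in sequentially. P k x} = (\<Union>m. ?A m)"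
    by (auto simp: eventually_sequentially)
  also have "emeasure M \<dots> = (SUP m. emeasure M (?A m))"
    by (rule SUP_emeasure_incseq[symmetric]) (auto simp: incseq_def)
  also have "\<dots> \<le> a"
  proof (rule SUP_least)
    fix m
    have "emeasure M (?A m) \<le> emeasure M {x \<in> space M. P m x}" by (rule emeasure_mono) auto
    then show "emeasure M (?A m) \<le> a" using le order_trans by blast
  qed
  finally show ?thesis .
qed

lemma ennreal_le_geometric_imp_zero:
  assumes "\<And>n. e \<le> ennreal (C * \<theta> ^ n)" "0 < \<theta>" "\<theta> < 1"
  shows "e = 0"
proof -
  have "(\<lambda>n. ennreal (C * \<theta> ^ n)) \<longlonglongrightarrow> ennreal (C * 0)"
    using assms(2,3) by (intro tendsto_ennrealI tendsto_mult tendsto_const LIMSEQ_power_zero) auto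
  then have "e \<le> ennreal (C * 0)" by (rule LIMSEQ_le_const) (use assms(1) in blast)
  then show ?thesis by simp
qed

lemma sum_geometric_tail_le:
  fixes \<theta> :: real
  assumes "0 < \<theta>" "\<theta> < 1"
  shows "(\<Sum>j<k. \<theta> ^ (k + m - j)) \<le> \<theta> ^ m / (1 - \<theta>)"
proof -
  have "(\<Sum>j<k. \<theta> ^ (k + m - j)) = (\<Sum>j<k. \<theta> ^ (Suc m + (k - Suc j)))"
  proof (rule sum.cong)
    fix j assume "j \<in> {..<k}"
    then have "k + m - j = Suc m + (k - Suc j)" by simp
    then show "\<theta> ^ (k + m - j) = \<theta> ^ (Suc m + (k - Suc j))" by (simp only:)
  qed simp
  also have "\<dots> = \<theta> ^ Suc m * (\<Sum>i<k. \<theta> ^ i)"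
    by (simp only: power_add sum_distrib_left sum.nat_diff_reindex[of "\<lambda>i. \<theta> ^ Suc m * \<theta> ^ i"])
  also have "\<dots> = \<theta> ^ Suc m * (1 - \<theta> ^ k) / (1 - \<theta>)" using assms by (simp add: sum_gp_strict)
  also have "\<dots> \<le> \<theta> ^ m * 1 / (1 - \<theta>)"
    using assms by (intro divide_right_mono mult_mono power_decreasing) (auto simp: power_le_one)
  finally show ?thesis by simp
qed

locale random_iteration = prob_space M for M :: "complex measure" +
  fixes R :: real
  assumes sets_M [measurable_cong]: "sets M = sets borel"
    and AE_norm_le: "AE c in M. cmod c + 2 \<le> R"
begin

text \<open>Restated because the sublocale rebinds the name to the product measure.\<close>

lemma prob_space_M: "prob_space M"
  by (rule prob_space_axioms)

sublocale sequence_space M by unfold_locales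

lemma measurable_seq_iter [measurable (raw)]:
  assumes [measurable]: "f \<in> measurable N S" "g \<in> borel_measurable N"
  shows "(\<lambda>x. seq_iter (f x) n (g x)) \<in> borel_measurable N"
proof (induction n)
  case (Suc n)
  note [measurable] = Suc
  have "(\<lambda>x. f x n) \<in> measurable N M" by measurable
  then have [measurable]: "(\<lambda>x. f x n) \<in> borel_measurable N"
    using measurable_cong_sets sets_M by blast
  have "(\<lambda>x. seq_iter (f x) n (g x) ^ 2 + f x n) \<in> borel_measurable N" by measurable
  then show ?case by (simp add: fq_def)
qed simp

lemma measurable_shift_seq [measurable]: "shift_seq j \<in> measurable S S"
  unfolding shift_seq_def[abs_def] by (rule measurable_PiM_single') (auto simp: space_PiM)

lemma AE_escape_radius: "AE \<omega> in S. escape_radius R \<omega>"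
proof -
  have "AE \<omega> in S. cmod (\<omega> n) + 2 \<le> R" for n
    by (rule AE_PiM_component) (auto intro: AE_norm_le prob_space_M)
  then show ?thesis by (simp add: escape_radius_def AE_all_countable)
qed

definition survival :: "nat \<Rightarrow> complex \<Rightarrow> ennreal" where
  "survival n z = emeasure S {\<omega> \<in> space S. cmod (seq_iter \<omega> n z) \<le> R}"

lemma emeasure_survival_shift:
  "emeasure S {\<omega> \<in> space S. cmod (seq_iter (shift_seq j \<omega>) n z) \<le> R} = survival n z"
proof -
  let ?A = "{\<omega> \<in> space S. cmod (seq_iter \<omega> n z) \<le> R}"
  have "distr S S (shift_seq j) = S"
    using distr_PiM_reindex[of UNIV "\<lambda>_. M" "\<lambda>i. j + i" UNIV] prob_space_M
    by (simp add: shift_seq_def[abs_def] restrict_UNIV)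
  then have "survival n z = emeasure (distr S S (shift_seq j)) ?A" by (simp add: survival_def)
  also have "\<dots> = emeasure S (shift_seq j -` ?A \<inter> space S)"
    by (rule emeasure_distr[OF measurable_shift_seq]) measurable
  also have "shift_seq j -` ?A \<inter> space S = {\<omega> \<in> space S. cmod (seq_iter (shift_seq j \<omega>) n z) \<le> R}"
    using measurable_space[OF measurable_shift_seq] by auto
  finally show ?thesis ..
qed

lemma survival_eq_nn_integral:
  "survival n z = (\<integral>\<^sup>+ \<omega>. indicator (cball 0 R) (seq_iter \<omega> n z) \<partial>S)"
proof -
  have "survival n z = (\<integral>\<^sup>+ \<omega>. indicator {\<omega> \<in> space S. cmod (seq_iter \<omega> n z) \<le> R} \<omega> \<partial>S)"
    unfolding survival_def by (rule nn_integral_indicator[symmetric]) measurable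
  also have "\<dots> = (\<integral>\<^sup>+ \<omega>. indicator (cball 0 R) (seq_iter \<omega> n z) \<partial>S)"
    by (intro nn_integral_cong) (auto simp: indicator_def)
  finally show ?thesis .
qed

lemma measurable_survival [measurable]: "survival n \<in> borel_measurable borel"
proof -
  have [measurable]: "cball (0 :: complex) R \<in> sets borel" by simp
  have "(\<lambda>z. \<integral>\<^sup>+ \<omega>. indicator (cball 0 R) (seq_iter \<omega> n z) \<partial>S) \<in> borel_measurable borel"
    by measurable
  then show ?thesis by (simp add: survival_eq_nn_integral[abs_def])
qed

lemma survival_Suc: "survival (Suc n) z = (\<integral>\<^sup>+ c. survival n (fq c z) \<partial>M)"
proof -
  let ?I = "\<lambda>\<omega>. indicator (cball 0 R) (seq_iter \<omega> (Suc n) z) :: ennreal"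
  have [measurable]: "cball (0 :: complex) R \<in> sets borel" by simp
  have [measurable]: "?I \<in> borel_measurable S" by measurable
  have "survival (Suc n) z = (\<integral>\<^sup>+ \<omega>. ?I \<omega> \<partial>distr (M \<Otimes>\<^sub>M S) S (\<lambda>(c, \<omega>). case_nat c \<omega>))"
    unfolding PiM_iter by (rule survival_eq_nn_integral)
  also have "\<dots> = (\<integral>\<^sup>+ x. ?I (case_nat (fst x) (snd x)) \<partial>(M \<Otimes>\<^sub>M S))"
    by (subst nn_integral_distr) (simp_all add: split_beta' del: seq_iter.simps)
  also have "\<dots> = (\<integral>\<^sup>+ c. \<integral>\<^sup>+ \<omega>. ?I (case_nat c \<omega>) \<partial>S \<partial>M)"
    by (subst P.nn_integral_fst[symmetric]) (simp_all del: seq_iter.simps)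
  also have "\<dots> = (\<integral>\<^sup>+ c. survival n (fq c z) \<partial>M)"
    unfolding survival_eq_nn_integral seq_iter_Suc_shift by (simp add: shift_seq_def)
  finally show ?thesis .
qed

lemma survival_le_1: "survival n z \<le> 1"
  unfolding survival_def by (rule P.emeasure_le_1)

lemma survival_outside:
  assumes "R < cmod z"
  shows "survival n z = 0"
  unfolding survival_def
proof (rule emeasure_eq_0_AE)
  show "AE \<omega> in S. \<not> cmod (seq_iter \<omega> n z) \<le> R"
    using AE_escape_radius
  proof eventually_elim
    case (elim \<omega>)
    then show ?case using norm_le_norm_seq_iter[OF elim, of z n] assms by simp
  qed
qed

lemma survival_antimono:
  assumes "m \<le> n"
  shows "survival n z \<le> survival m z"
  unfolding survival_def
proof (rule emeasure_mono_AE)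
  show "AE \<omega> in S. \<omega> \<in> {\<omega> \<in> space S. cmod (seq_iter \<omega> n z) \<le> R} \<longrightarrow>
      \<omega> \<in> {\<omega> \<in> space S. cmod (seq_iter \<omega> m z) \<le> R}"
    using AE_escape_radius by eventually_elim (use norm_seq_iter_le_antimono assms in blast)
qed measurable

lemma survival_add_le:
  assumes "\<And>z. survival m z \<le> q"
  shows "survival (m + n) z \<le> q * survival n z"
proof (induction n arbitrary: z)
  case 0
  show ?case
  proof (cases "cmod z \<le> R")
    case True
    then have "survival 0 z = 1" by (simp add: survival_def P.emeasure_space_1)
    then show ?thesis using assms by simp
  qed (simp add: survival_outside)
next
  case (Suc n)
  have "(\<integral>\<^sup>+ c. survival (m + n) (fq c z) \<partial>M) \<le> (\<integral>\<^sup>+ c. q * survival n (fq c z) \<partial>M)"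
    by (intro nn_integral_mono Suc)
  also have "\<dots> = q * (\<integral>\<^sup>+ c. survival n (fq c z) \<partial>M)"
    unfolding fq_def by (rule nn_integral_cmult) measurable
  finally show ?case by (simp add: survival_Suc)
qed

lemma survival_locally_less_1:
  assumes support: "range \<omega> \<subseteq> measure_support M" and escape: "R < cmod (seq_iter \<omega> n z)"
  shows "\<exists>q. 0 \<le> q \<and> q < 1 \<and> (\<exists>\<delta>>0. \<forall>w\<in>ball z \<delta>. survival n w \<le> ennreal q)"
proof -
  obtain \<delta> where \<delta>: "\<delta> > 0" "\<And>\<omega>' w. \<forall>i<n. dist (\<omega>' i) (\<omega> i) < \<delta> \<Longrightarrow> dist w z < \<delta> \<Longrightarrow>
      dist (seq_iter \<omega>' n w) (seq_iter \<omega> n z) < cmod (seq_iter \<omega> n z) - R"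
    using seq_iter_close[of "cmod (seq_iter \<omega> n z) - R"] escape by (metis diff_gt_0_iff_gt)
  define A where "A = {\<omega>' \<in> space S. \<forall>i\<in>{..<n}. \<omega>' i \<in> ball (\<omega> i) \<delta>}"
  have [measurable]: "ball (\<omega> i) \<delta> \<in> sets M" for i by (simp add: sets_M)
  have A: "A \<in> sets S" unfolding A_def by measurable
  have "emeasure S A = (\<Prod>i\<in>{..<n}. emeasure M (ball (\<omega> i) \<delta>))"
    unfolding A_def by (rule emeasure_PiM_Collect) (auto simp: sets_M)
  also have "\<dots> > 0"
    using support \<delta>(1) by (auto simp: measure_support_def zero_less_iff_neq_zero)
  finally have "P.prob A > 0" by (simp add: P.emeasure_eq_measure)
  moreover have "survival n w \<le> ennreal (1 - P.prob A)" if w: "w \<in> ball z \<delta>" for w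
  proof -
    have "R < cmod (seq_iter \<omega>' n w)" if "\<omega>' \<in> A" for \<omega>'
    proof -
      have "dist (seq_iter \<omega>' n w) (seq_iter \<omega> n z) < cmod (seq_iter \<omega> n z) - R"
        using w that by (intro \<delta>(2)) (auto simp: A_def dist_commute)
      then show ?thesis
        using norm_triangle_sub[of "seq_iter \<omega> n z" "seq_iter \<omega>' n w"]
        by (simp add: dist_norm norm_minus_commute)
    qed
    then have "survival n w \<le> emeasure S (space S - A)"
      unfolding survival_def using A by (intro emeasure_mono) (auto simp: not_le[symmetric])
    then show ?thesis using P.prob_compl[OF A] by (simp add: P.emeasure_eq_measure)
  qed
  ultimately show ?thesis
    using \<delta>(1) by (intro exI[of _ "1 - P.prob A"] conjI exI[of _ \<delta>]) auto
qed

lemma emeasure_not_critical_points_escape_le: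
  assumes \<theta>: "C > 0" "0 < \<theta>" "\<theta> < 1" and survival: "\<And>n z. survival n z \<le> ennreal (C * \<theta> ^ n)"
  shows "emeasure S {\<omega> \<in> space S. \<not> critical_points_escape R \<omega> m k} \<le> ennreal (C / (1 - \<theta>) * \<theta> ^ m)"
proof -
  let ?X = "\<lambda>j. {\<omega> \<in> space S. cmod (seq_iter (shift_seq j \<omega>) (k + m - j) 0) \<le> R}"
  have "{\<omega> \<in> space S. \<not> critical_points_escape R \<omega> m k} = (\<Union>j<k. ?X j)"
    by (auto simp: critical_points_escape_def not_less)
  also have "emeasure S \<dots> \<le> (\<Sum>j<k. emeasure S (?X j))"
    by (rule emeasure_subadditive_finite) auto
  also have "\<dots> \<le> (\<Sum>j<k. ennreal (C * \<theta> ^ (k + m - j)))"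
    unfolding emeasure_survival_shift by (intro sum_mono survival)
  also have "\<dots> = ennreal (C * (\<Sum>j<k. \<theta> ^ (k + m - j)))"
    using \<theta> by (subst sum_ennreal) (auto simp: sum_distrib_left)
  also have "\<dots> \<le> ennreal (C * (\<theta> ^ m / (1 - \<theta>)))"
    using \<theta> by (intro ennreal_leI mult_left_mono sum_geometric_tail_le) auto
  finally show ?thesis by (simp add: mult.commute)
qed

context
  assumes escape: "\<And>z. \<exists>\<omega> n. range \<omega> \<subseteq> measure_support M \<and> R < cmod (seq_iter \<omega> n z)"
begin

lemma survival_uniformly_less_1:
  "\<exists>N q. N > 0 \<and> 0 < q \<and> q < 1 \<and> (\<forall>z. survival N z \<le> ennreal q)"
proof -
  have "\<exists>n q \<delta>. 0 \<le> q \<and> q < 1 \<and> \<delta> > 0 \<and> (\<forall>w\<in>ball z \<delta>. survival n w \<le> ennreal q)" for z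
    using escape[of z] survival_locally_less_1 by meson
  then obtain n q \<delta> where q: "\<And>z. 0 \<le> q z" "\<And>z. q z < 1" and \<delta>: "\<And>z. \<delta> z > 0"
    and nq: "\<And>z w. w \<in> ball z (\<delta> z) \<Longrightarrow> survival (n z) w \<le> ennreal (q z)" by metis
  obtain D where D: "finite D" "cball 0 R \<subseteq> (\<Union>z\<in>D. ball z (\<delta> z))"
  proof (rule compactE_image[of "cball 0 R" "cball 0 R" "\<lambda>z. ball z (\<delta> z)"])
    show "cball 0 R \<subseteq> (\<Union>z\<in>cball 0 R. ball z (\<delta> z))" using \<delta> by force
  qed auto
  define N where "N = Suc (\<Sum>z\<in>D. n z)"
  define Q where "Q = Max (insert (1/2) (q ` D))"
  have "1/2 \<le> Q" unfolding Q_def using D(1) by (intro Max_ge) auto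
  then have "0 < Q" by simp
  moreover have "Q < 1" unfolding Q_def using D(1) q by (subst Max_less_iff) auto
  moreover have "survival N w \<le> ennreal Q" for w
  proof (cases "cmod w \<le> R")
    case True
    then obtain z where z: "z \<in> D" "w \<in> ball z (\<delta> z)" using D(2) by auto
    have "n z \<le> N" unfolding N_def using D(1) z(1) by (intro le_SucI member_le_sum) auto
    then have "survival N w \<le> survival (n z) w" by (rule survival_antimono)
    also have "\<dots> \<le> ennreal (q z)" by (rule nq[OF z(2)])
    also have "\<dots> \<le> ennreal Q" unfolding Q_def using D(1) z(1) by (intro ennreal_leI Max_ge) auto
    finally show ?thesis .
  qed (simp add: survival_outside)
  ultimately show ?thesis by (intro exI[of _ N] exI[of _ Q]) (simp add: N_def)
qed

lemma survival_le_geometric: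
  obtains C \<theta> :: real where "C > 0" "0 < \<theta>" "\<theta> < 1" "\<And>n z. survival n z \<le> ennreal (C * \<theta> ^ n)"
proof -
  obtain N q where N: "N > 0" and q: "0 < q" "q < 1" and survival_N: "\<And>z. survival N z \<le> ennreal q"
    using survival_uniformly_less_1 by blast
  have multiples: "survival (N * i) z \<le> ennreal (q ^ i)" for i z
  proof (induction i)
    case (Suc i)
    have "survival (N * Suc i) z \<le> ennreal q * survival (N * i) z"
      using survival_add_le[OF survival_N, of "N * i" z] by simp
    also have "\<dots> \<le> ennreal q * ennreal (q ^ i)" by (intro mult_left_mono Suc) simp
    also have "\<dots> = ennreal (q ^ Suc i)" using q by (simp add: ennreal_mult)
    finally show ?case .
  qed (simp add: survival_le_1)
  define \<theta> where "\<theta> = root N q"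
  have \<theta>: "0 < \<theta>" "\<theta> < 1" "\<theta> ^ N = q" using N q by (simp_all add: \<theta>_def)
  have "survival n z \<le> ennreal (1 / q * \<theta> ^ n)" for n z
  proof -
    have "n \<le> N * (n div N) + N"
      using N by (metis add_left_mono less_imp_le mod_less_divisor mult_div_mod_eq)
    then have "\<theta> ^ (N * (n div N) + N) \<le> \<theta> ^ n" using \<theta> by (intro power_decreasing) auto
    then have "q ^ (n div N) \<le> 1 / q * \<theta> ^ n"
      using q by (simp add: power_add power_mult \<theta>(3) field_simps)
    have "survival n z \<le> survival (N * (n div N)) z" by (rule survival_antimono) simp
    also have "\<dots> \<le> ennreal (q ^ (n div N))" by (rule multiples)
    also have "\<dots> \<le> ennreal (1 / q * \<theta> ^ n)" by (rule ennreal_leI) fact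
    finally show ?thesis .
  qed
  then show ?thesis using that[of "1 / q" \<theta>] q \<theta> by simp
qed

lemma AE_not_in_filled_julia: "AE \<omega> in S. z \<notin> filled_julia \<omega>"
proof -
  obtain C \<theta> :: real where \<theta>: "0 < \<theta>" "\<theta> < 1" "\<And>n z. survival n z \<le> ennreal (C * \<theta> ^ n)"
    using survival_le_geometric by metis
  let ?B = "{\<omega> \<in> space S. \<forall>n. cmod (seq_iter \<omega> n z) \<le> R}"
  have "emeasure S ?B \<le> ennreal (C * \<theta> ^ n)" for n
  proof -
    have "emeasure S ?B \<le> survival n z"
      unfolding survival_def by (rule emeasure_mono) (blast, measurable)
    then show ?thesis using \<theta>(3) order_trans by blast
  qed
  then have "emeasure S ?B = 0" using \<theta>(1,2) by (rule ennreal_le_geometric_imp_zero)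
  then have "AE \<omega> in S. \<not> (\<forall>n. cmod (seq_iter \<omega> n z) \<le> R)"
    by (subst AE_iff_measurable[OF _ refl]) auto
  with AE_escape_radius show ?thesis by eventually_elim (simp add: filled_julia_iff)
qed

lemma AE_interior_filled_julia_empty: "AE \<omega> in S. interior (filled_julia \<omega>) = {}"
proof -
  obtain D :: "complex set" where D: "countable D" "\<And>X. open X \<Longrightarrow> X \<noteq> {} \<Longrightarrow> \<exists>d\<in>D. d \<in> X"
    using countable_dense_exists[where 'a=complex] by blast
  have "AE \<omega> in S. \<forall>z\<in>D. z \<notin> filled_julia \<omega>"
    unfolding AE_ball_countable[OF D(1)] using AE_not_in_filled_julia by blast
  then show ?thesis
    by eventually_elim (use D(2)[OF open_interior] interior_subset in blast)
qed

lemma AE_critical_points_escape: "AE \<omega> in S. \<exists>m. \<exists>\<^sub>\<infinity>k. critical_points_escape R \<omega> m k"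
proof -
  obtain C \<theta> :: real where \<theta>: "C > 0" "0 < \<theta>" "\<theta> < 1" "\<And>n z. survival n z \<le> ennreal (C * \<theta> ^ n)"
    using survival_le_geometric by metis
  have [measurable]: "Measurable.pred S (\<lambda>\<omega>. \<not> critical_points_escape R \<omega> m k)" for m k
    unfolding critical_points_escape_def by measurable
  let ?B = "\<lambda>m. {\<omega> \<in> space S. \<forall>\<^sub>F k in sequentially. \<not> critical_points_escape R \<omega> m k}"
  have "?B m \<in> sets S" for m unfolding eventually_sequentially by measurable
  then have [measurable]: "(\<Inter>m. ?B m) \<in> sets S" by blast
  have "emeasure S (\<Inter>m. ?B m) \<le> ennreal (C / (1 - \<theta>) * \<theta> ^ m)" for m
  proof -
    have "emeasure S (\<Inter>m. ?B m) \<le> emeasure S (?B m)"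
      by (rule emeasure_mono) (use \<open>?B m \<in> sets S\<close> in auto)
    also have "\<dots> \<le> ennreal (C / (1 - \<theta>) * \<theta> ^ m)"
      by (rule emeasure_eventually_le[OF _ emeasure_not_critical_points_escape_le[OF \<theta>]]) measurable
    finally show ?thesis .
  qed
  then have "emeasure S (\<Inter>m. ?B m) = 0" using \<theta>(2,3) by (rule ennreal_le_geometric_imp_zero)
  then show ?thesis
    by (intro AE_I[where N = "\<Inter>m. ?B m"]) (auto simp: not_frequently cofinite_eq_sequentially)
qed

lemma AE_julia_totally_disconnected: "AE \<omega> in S. totally_disconnected (julia \<omega>)"
  using AE_escape_radius AE_interior_filled_julia_empty AE_critical_points_escape
  by eventually_elim (use julia_totally_disconnected in blast)

lemma AE_critical_orbit_tendsto_infinity: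
  "AE \<omega> in S. filterlim (\<lambda>n. seq_iter \<omega> n z) at_infinity sequentially"
  using AE_escape_radius AE_not_in_filled_julia[of z]
  by eventually_elim (use not_in_filled_julia_iff in blast)

end

end

lemma sets_mu [simp, measurable_cong]: "sets (mu c r) = sets borel"
  by (simp add: mu_def)

lemma emeasure_lborel_cball_pos: "r > 0 \<Longrightarrow> emeasure lborel (cball (c::complex) r) > 0"
  using content_cball_pos[of r c] emeasure_lborel_cball_finite[of c r]
  by (simp add: emeasure_eq_ennreal_measure top.not_eq_extremum)

lemma prob_space_mu: "r > 0 \<Longrightarrow> prob_space (mu c r)"
  using emeasure_lborel_cball_pos[of r c] emeasure_lborel_cball_finite[of c r]
  by (auto simp: mu_def intro!: prob_space_uniform_measure)

lemma AE_mu_cball: "r > 0 \<Longrightarrow> AE x in mu c r. x \<in> cball c r"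
  unfolding mu_def by (auto intro!: AE_uniform_measureI)

lemma cball_subset_measure_support_mu:
  assumes "r > 0"
  shows "cball c r \<subseteq> measure_support (mu c r)"
  unfolding measure_support_def
proof (intro subsetI CollectI allI impI)
  fix a and \<delta> :: real assume "a \<in> cball c r" "\<delta> > 0"
  then have "a \<in> closure (ball c r)" using assms by (simp add: closure_ball)
  then obtain b where "b \<in> ball c r" "dist b a < \<delta>"
    using \<open>\<delta> > 0\<close> unfolding closure_approachable by blast
  then have "open (ball c r \<inter> ball a \<delta>)" "b \<in> ball c r \<inter> ball a \<delta>" by (auto simp: dist_commute)
  then obtain e where e: "e > 0" "cball b e \<subseteq> ball c r \<inter> ball a \<delta>"
    unfolding open_contains_cball by blast
  have "0 < emeasure lborel (cball b e)" using e(1) by (rule emeasure_lborel_cball_pos)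
  also have "\<dots> \<le> emeasure lborel (cball c r \<inter> ball a \<delta>)"
    using e(2) by (intro emeasure_mono) auto
  finally have "0 < emeasure lborel (cball c r \<inter> ball a \<delta>)" .
  moreover have "emeasure lborel (cball c r) \<noteq> \<infinity>" using emeasure_lborel_cball_finite[of c r] by simp
  ultimately show "emeasure (mu c r) (ball a \<delta>) > 0"
    unfolding mu_def using assms by (simp add: ennreal_zero_less_divide top.not_eq_extremum)
qed

lemma random_iteration_mu:
  assumes "r > 0"
  shows "random_iteration (mu c r) (cmod c + r + 2)"
proof (intro random_iteration.intro random_iteration_axioms.intro prob_space_mu sets_mu assms)
  show "AE x in mu c r. cmod x + 2 \<le> cmod c + r + 2"
    using AE_mu_cball[OF assms] by eventually_elim (simp add: mem_cball_imp_norm_le)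
qed

lemma AE_Prob_imp_ex_Omega:
  assumes "r > 0" "AE \<omega> in Prob c r. P \<omega>"
  shows "\<exists>\<omega>\<in>Omega c r. P \<omega>"
proof (rule ccontr)
  assume none: "\<not> (\<exists>\<omega>\<in>Omega c r. P \<omega>)"
  interpret prob_space "Prob c r"
    unfolding Prob_def by (intro prob_space_PiM prob_space_mu assms)
  have "AE \<omega> in Prob c r. \<omega> n \<in> cball c r" for n
    unfolding Prob_def
    by (rule AE_PiM_component) (use prob_space_mu AE_mu_cball assms(1) in auto)
  then have "AE \<omega> in Prob c r. \<omega> \<in> Omega c r"
    by (simp add: Omega_def AE_all_countable del: mem_cball)
  with assms(2) have "AE \<omega> in Prob c r. False" by eventually_elim (use none in blast)
  then show False by simp
qed

subsection \<open>The bifurcation radius\<close>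

lemma planar_minimal_setD:
  assumes "planar_minimal_set (Gsg c r) L"
  shows "L \<noteq> {}" "compact L" "forward_invariant (cball c r) L"
  using assms unfolding planar_minimal_set_def forward_invariant_cball_iff by auto

lemma planar_minimal_set_radius_0: "\<exists>L. planar_minimal_set (Gsg c 0) L"
proof -
  define z where "z = (1 + csqrt (1 - 4 * c)) / 2"
  have "2 * z - 1 = csqrt (1 - 4 * c)" by (simp add: z_def field_simps)
  then have "(2 * z - 1)^2 = 1 - 4 * c" by simp
  then have "4 * (z^2 + c) = 4 * z" by (simp add: power2_eq_square algebra_simps)
  then have "fq c z = z" unfolding fq_def by (simp only: mult_cancel_left) simp
  then have "planar_minimal_set (Gsg c 0) {z}"
    unfolding planar_minimal_set_def forward_invariant_cball_iff[symmetric]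
    by (auto simp: forward_invariant_def)
  then show ?thesis ..
qed

lemma forward_invariant_radius_le:
  assumes inv: "forward_invariant (cball c r) L" and L: "compact L" "L \<noteq> {}" and "r \<ge> 0"
  shows "r \<le> cmod c + 1"
proof -
  obtain z where z: "z \<in> L" "\<And>w. w \<in> L \<Longrightarrow> cmod w \<le> cmod z"
    using continuous_attains_sup[OF L, of cmod] continuous_on_norm_id by blast
  obtain v where v: "cmod v = r" "cmod (z^2 + v) = cmod (z^2) + r"
    using obtain_norm_add_eq[OF \<open>r \<ge> 0\<close>] by blast
  have "c + v \<in> cball c r" using v(1) by (simp add: dist_norm)
  then have "fq (c + v) z \<in> L" using inv z(1) unfolding forward_invariant_def by blast
  then have "cmod (fq (c + v) z) \<le> cmod z" by (rule z(2))
  moreover have "cmod (z^2 + v) - cmod c \<le> cmod (fq (c + v) z)"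
    unfolding fq_def using norm_diff_ineq[of "z^2 + v" c] by (simp add: algebra_simps)
  ultimately have "cmod z ^ 2 + r \<le> cmod z + cmod c" using v(2) by (simp add: norm_power)
  moreover have "cmod z \<le> cmod z ^ 2 + 1" using zero_le_power2[of "cmod z - 1/2"]
    by (simp add: power2_eq_square algebra_simps)
  ultimately show ?thesis by simp
qed

lemma bdd_above_planar_radii: "bdd_above {r. r \<ge> 0 \<and> (\<exists>L. planar_minimal_set (Gsg c r) L)}"
  using forward_invariant_radius_le planar_minimal_setD
  by (intro bdd_aboveI[of _ "cmod c + 1"]) blast

lemma planar_minimal_set_imp_le_r_bif: "planar_minimal_set (Gsg c r) L \<Longrightarrow> r \<ge> 0 \<Longrightarrow> r \<le> r_bif c"
  unfolding r_bif_def by (intro cSup_upper bdd_above_planar_radii) auto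

lemma less_r_bif_imp_planar_minimal_set:
  assumes "r < r_bif c"
  shows "\<exists>s>r. \<exists>L. planar_minimal_set (Gsg c s) L"
proof -
  have "{r. r \<ge> 0 \<and> (\<exists>L. planar_minimal_set (Gsg c r) L)} \<noteq> {}"
    using planar_minimal_set_radius_0[of c] by auto
  then show ?thesis
    using assms less_cSup_iff[OF _ bdd_above_planar_radii] unfolding r_bif_def by blast
qed

lemma bounded_Gsg_orbit_iff:
  "bounded (Gsg_orbit c r z) \<longleftrightarrow> (\<forall>\<omega>\<in>Omega c r. z \<in> filled_julia \<omega>)"
proof
  assume bounded: "bounded (Gsg_orbit c r z)"
  have "range (\<lambda>n. seq_iter \<omega> (Suc n) z) \<subseteq> Gsg_orbit c r z" if "\<omega> \<in> Omega c r" for \<omega>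
    unfolding Gsg_orbit_eq using that by blast
  then show "\<forall>\<omega>\<in>Omega c r. z \<in> filled_julia \<omega>"
    unfolding filled_julia_iff_bounded_Suc using bounded_subset[OF bounded] by blast
next
  assume "\<forall>\<omega>\<in>Omega c r. z \<in> filled_julia \<omega>"
  then have "cmod (seq_iter \<omega> n z) \<le> cmod c + r + 2" if "\<omega> \<in> Omega c r" for \<omega> n
    using that filled_julia_iff[OF Omega_escape_radius] by blast
  then show "bounded (Gsg_orbit c r z)"
    unfolding Gsg_orbit_eq bounded_iff by blast
qed

lemma critical_orbit_subset_invariant_set:
  assumes "superattracting ct" "ct \<in> ball c r"
    and L: "forward_invariant (cball c r) L" "compact L" "L \<noteq> {}"
  shows "Gsg_orbit c r 0 \<subseteq> L"
proof -
  have "0 \<in> L"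
    using assms(1,2) L by (intro superattracting_imp_zero_in_invariant_set[of ct "cball c r"]) auto
  then show ?thesis using L(1) unfolding forward_invariant_cball_iff by blast
qed

lemma tendsto_seq_iter:
  assumes "\<And>i. ((\<lambda>t. w t i) \<longlongrightarrow> \<omega> i) F"
  shows "((\<lambda>t. seq_iter (w t) n z) \<longlongrightarrow> seq_iter \<omega> n z) F"
  by (induction n) (auto simp: fq_def intro!: tendsto_intros assms)

lemma filled_julia_parameter_limit:
  assumes lim: "\<And>i. ((\<lambda>t. w t i) \<longlongrightarrow> \<omega> i) F" and "F \<noteq> bot" and R: "escape_radius R \<omega>"
    and bounded: "\<forall>\<^sub>F t in F. escape_radius R (w t) \<and> z \<in> filled_julia (w t)"
  shows "z \<in> filled_julia \<omega>"
  unfolding filled_julia_iff[OF R]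
proof
  fix n
  have "\<forall>\<^sub>F t in F. cmod (seq_iter (w t) n z) \<le> R"
    using bounded by eventually_elim (use filled_julia_iff in blast)
  then show "cmod (seq_iter \<omega> n z) \<le> R"
    by (intro tendsto_upperbound[OF tendsto_norm[OF tendsto_seq_iter[OF lim]]] \<open>F \<noteq> bot\<close>)
qed

lemma less_r_bif_imp_bounded_Gsg_orbit:
  assumes ct: "superattracting ct" "ct \<in> cball c r" and "r < r_bif c"
  shows "bounded (Gsg_orbit c r 0)"
proof -
  obtain s L where "r < s" and L: "planar_minimal_set (Gsg c s) L"
    using less_r_bif_imp_planar_minimal_set[OF \<open>r < r_bif c\<close>] by blast
  have "Gsg_orbit c s 0 \<subseteq> L"
    using ct \<open>r < s\<close>
    by (intro critical_orbit_subset_invariant_set[of ct] planar_minimal_setD[OF L]) auto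
  then have "bounded (Gsg_orbit c s 0)"
    using compact_imp_bounded[OF planar_minimal_setD(2)[OF L]] bounded_subset by blast
  then show ?thesis
    unfolding bounded_Gsg_orbit_iff using Omega_mono[of r s c] \<open>r < s\<close> by auto
qed

text \<open>A parameter sequence for the radius \<open>r\<close> is the limit of its contractions towards \<open>c\<close>.\<close>

lemma le_r_bif_imp_bounded_Gsg_orbit:
  assumes ct: "superattracting ct" "ct \<in> ball c r" and "r \<le> r_bif c"
  shows "bounded (Gsg_orbit c r 0)"
  unfolding bounded_Gsg_orbit_iff
proof
  fix \<omega> assume \<omega>: "\<omega> \<in> Omega c r"
  have "r > 0" using ct(2) by (metis ball_empty empty_iff not_le)
  define w where "w t = (\<lambda>i. c + of_real t * (\<omega> i - c))" for t :: real
  have w: "w t \<in> Omega c (t * r)" if "t \<ge> 0" for t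
    using \<omega> that unfolding Omega_def w_def
    by (auto simp: dist_norm norm_mult norm_minus_commute intro!: mult_left_mono)
  show "0 \<in> filled_julia \<omega>"
  proof (rule filled_julia_parameter_limit[where w = w and F = "at_left 1"])
    show "((\<lambda>t. w t i) \<longlongrightarrow> \<omega> i) (at_left 1)" for i
    proof -
      have "((\<lambda>t. c + of_real t * (\<omega> i - c)) \<longlongrightarrow> c + of_real 1 * (\<omega> i - c)) (at_left 1)"
        by (intro tendsto_intros)
      then show ?thesis by (simp add: w_def)
    qed
    have "dist c ct / r < 1" using ct(2) \<open>r > 0\<close> by simp
    then have "\<forall>\<^sub>F t in at_left 1. t \<in> {dist c ct / r<..<1}" by (rule eventually_at_left_real)
    then show "\<forall>\<^sub>F t in at_left 1. escape_radius (cmod c + r + 2) (w t) \<and> 0 \<in> filled_julia (w t)"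
    proof eventually_elim
      case (elim t)
      then have t: "dist c ct < t * r" "t < 1" "t \<ge> 0"
        using \<open>r > 0\<close> order_trans[of 0 "dist c ct / r" t] by (auto simp: field_simps)
      then have "t * r < r" using \<open>r > 0\<close> by simp
      then have "bounded (Gsg_orbit c (t * r) 0)"
        using t(1) \<open>r \<le> r_bif c\<close> by (intro less_r_bif_imp_bounded_Gsg_orbit[OF ct(1)]) auto
      then have "0 \<in> filled_julia (w t)" using w[OF t(3)] unfolding bounded_Gsg_orbit_iff by blast
      moreover have "w t \<in> Omega c r"
        using w[OF t(3)] Omega_mono[of "t * r" r c] \<open>t * r < r\<close> by auto
      ultimately show ?case using Omega_escape_radius by blast
    qed
  qed (use \<omega> Omega_escape_radius in auto)
qed

context
  fixes c ct :: complex and r :: real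
  assumes ct: "superattracting ct" "ct \<in> ball c r"
begin

private lemma r_pos: "r > 0"
  using ct(2) by (metis ball_empty empty_iff not_le)

lemma Gsg_orbit_nonempty: "Gsg_orbit c r z \<noteq> {}"
  using Gsg.gen[of c c r] r_pos by auto

lemma planar_minimal_critical_orbit_iff:
  "planar_minimal_set (Gsg c r) (closure (Gsg_orbit c r 0)) \<longleftrightarrow> bounded (Gsg_orbit c r 0)"
proof
  assume "planar_minimal_set (Gsg c r) (closure (Gsg_orbit c r 0))"
  then show "bounded (Gsg_orbit c r 0)"
    using planar_minimal_setD(2) compact_imp_bounded bounded_subset closure_subset by metis
next
  assume "bounded (Gsg_orbit c r 0)"
  then have "compact (closure (Gsg_orbit c r 0))" by (simp add: compact_closure)
  moreover have "closure (Gsg_orbit c r 0) \<subseteq> K"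
    if "forward_invariant (cball c r) K" "compact K" "K \<noteq> {}" for K
    using critical_orbit_subset_invariant_set[OF ct that] compact_imp_closed[OF that(2)]
    by (rule closure_minimal)
  ultimately show "planar_minimal_set (Gsg c r) (closure (Gsg_orbit c r 0))"
    unfolding planar_minimal_set_def forward_invariant_cball_iff[symmetric]
    using Gsg_orbit_nonempty forward_invariant_closure[OF forward_invariant_Gsg_orbit] by auto
qed

lemma le_r_bif_iff: "r \<le> r_bif c \<longleftrightarrow> bounded (Gsg_orbit c r 0)"
  using le_r_bif_imp_bounded_Gsg_orbit[OF ct] planar_minimal_critical_orbit_iff
    planar_minimal_set_imp_le_r_bif r_pos by (metis less_imp_le)

lemma unbounded_critical_orbit_imp_escape:
  assumes "\<not> bounded (Gsg_orbit c r 0)"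
  shows "\<exists>\<omega> n. range \<omega> \<subseteq> measure_support (mu c r) \<and> cmod c + r + 2 < cmod (seq_iter \<omega> n z)"
proof -
  have "\<not> bounded (Gsg_orbit c r z)"
  proof
    assume "bounded (Gsg_orbit c r z)"
    then have compact: "compact (closure (Gsg_orbit c r z))" by (simp add: compact_closure)
    have "Gsg_orbit c r 0 \<subseteq> closure (Gsg_orbit c r z)"
      using Gsg_orbit_nonempty
      by (intro critical_orbit_subset_invariant_set[OF ct] compact
          forward_invariant_closure forward_invariant_Gsg_orbit) simp
    then show False using assms compact_imp_bounded[OF compact] bounded_subset by blast
  qed
  then obtain \<omega> where \<omega>: "\<omega> \<in> Omega c r" "z \<notin> filled_julia \<omega>"
    unfolding bounded_Gsg_orbit_iff by blast
  then obtain n where "cmod c + r + 2 < cmod (seq_iter \<omega> n z)"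
    using filled_julia_iff[OF Omega_escape_radius] by (auto simp: not_le)
  moreover have "range \<omega> \<subseteq> measure_support (mu c r)"
    using \<omega>(1) cball_subset_measure_support_mu[OF r_pos] unfolding Omega_def by blast
  ultimately show ?thesis by blast
qed

lemma AE_critical_orbit_escapes_iff:
  "(AE \<omega> in Prob c r. filterlim (\<lambda>n. seq_iter \<omega> n 0) at_infinity sequentially)
    \<longleftrightarrow> \<not> bounded (Gsg_orbit c r 0)"
proof
  assume "AE \<omega> in Prob c r. filterlim (\<lambda>n. seq_iter \<omega> n 0) at_infinity sequentially"
  then obtain \<omega> where "\<omega> \<in> Omega c r" "0 \<notin> filled_julia \<omega>"
    using AE_Prob_imp_ex_Omega[OF r_pos] not_in_filled_julia_iff[OF Omega_escape_radius] by blast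
  then show "\<not> bounded (Gsg_orbit c r 0)" unfolding bounded_Gsg_orbit_iff by blast
next
  assume "\<not> bounded (Gsg_orbit c r 0)"
  then show "AE \<omega> in Prob c r. filterlim (\<lambda>n. seq_iter \<omega> n 0) at_infinity sequentially"
    unfolding Prob_def
    by (intro random_iteration.AE_critical_orbit_tendsto_infinity[OF random_iteration_mu[OF r_pos]]
        unbounded_critical_orbit_imp_escape)
qed

lemma bounded_imp_connected_julia:
  assumes "bounded (Gsg_orbit c r 0)" "\<omega> \<in> Omega c r"
  shows "connected (julia \<omega>)"
  using assms unfolding bounded_Gsg_orbit_iff
  by (intro connected_julia[OF Omega_escape_radius]) (auto intro: shift_seq_in_Omega)

lemma AE_totally_disconnected_julia_iff:
  "(AE \<omega> in Prob c r. totally_disconnected (julia \<omega>)) \<longleftrightarrow> \<not> bounded (Gsg_orbit c r 0)"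
proof
  assume "AE \<omega> in Prob c r. totally_disconnected (julia \<omega>)"
  then obtain \<omega> where "\<omega> \<in> Omega c r" "totally_disconnected (julia \<omega>)"
    using AE_Prob_imp_ex_Omega[OF r_pos] by blast
  then show "\<not> bounded (Gsg_orbit c r 0)"
    using bounded_imp_connected_julia
      connected_julia_imp_not_totally_disconnected[OF Omega_escape_radius] by blast
next
  assume "\<not> bounded (Gsg_orbit c r 0)"
  then show "AE \<omega> in Prob c r. totally_disconnected (julia \<omega>)"
    unfolding Prob_def
    by (intro random_iteration.AE_julia_totally_disconnected[OF random_iteration_mu[OF r_pos]]
        unbounded_critical_orbit_imp_escape)
qed

lemma all_connected_julia_iff:
  "(\<forall>\<omega>\<in>Omega c r. connected (julia \<omega>)) \<longleftrightarrow> bounded (Gsg_orbit c r 0)"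
proof
  assume connected: "\<forall>\<omega>\<in>Omega c r. connected (julia \<omega>)"
  show "bounded (Gsg_orbit c r 0)"
  proof (rule ccontr)
    assume "\<not> ?thesis"
    then obtain \<omega> where "\<omega> \<in> Omega c r" "totally_disconnected (julia \<omega>)"
      using AE_totally_disconnected_julia_iff AE_Prob_imp_ex_Omega[OF r_pos] by blast
    then show False
      using connected connected_julia_imp_not_totally_disconnected[OF Omega_escape_radius] by blast
  qed
qed (use bounded_imp_connected_julia in blast)

end

theorem theorem4p6:
  fixes c :: complex and r :: real
  assumes "r \<ge> 0"
    and "\<exists>ct \<in> interior (cball c r). superattracting ct"
  shows
   "((r \<le> r_bif c) \<longleftrightarrow> (\<forall>\<omega>\<in>Omega c r. bounded (range (\<lambda>n. seq_iter \<omega> (Suc n) 0))))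
    \<and> ((\<forall>\<omega>\<in>Omega c r. bounded (range (\<lambda>n. seq_iter \<omega> (Suc n) 0)))
         \<longleftrightarrow> (\<forall>\<omega>\<in>Omega c r. connected (julia \<omega>)))
    \<and> ((\<forall>\<omega>\<in>Omega c r. connected (julia \<omega>))
         \<longleftrightarrow> planar_minimal_set (Gsg c r) (closure (\<Union>g\<in>Gsg c r. {g 0})))
    \<and> ((r > r_bif c) \<longleftrightarrow>
         (AE \<omega> in Prob c r. filterlim (\<lambda>n. seq_iter \<omega> n 0) at_infinity sequentially))
    \<and> ((AE \<omega> in Prob c r. filterlim (\<lambda>n. seq_iter \<omega> n 0) at_infinity sequentially)
         \<longleftrightarrow> (AE \<omega> in Prob c r. totally_disconnected (julia \<omega>)))
    \<and> ((AE \<omega> in Prob c r. totally_disconnected (julia \<omega>))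
         \<longleftrightarrow> \<not> bounded (closure (\<Union>g\<in>Gsg c r. {g 0})))
    \<and> ((r \<le> r_bif c
          \<and> (\<forall>\<omega>\<in>Omega c r. bounded (range (\<lambda>n. seq_iter \<omega> (Suc n) 0)))
          \<and> (\<forall>\<omega>\<in>Omega c r. connected (julia \<omega>))
          \<and> planar_minimal_set (Gsg c r) (closure (\<Union>g\<in>Gsg c r. {g 0})))
       \<or> (r > r_bif c
          \<and> (AE \<omega> in Prob c r. filterlim (\<lambda>n. seq_iter \<omega> n 0) at_infinity sequentially)
          \<and> (AE \<omega> in Prob c r. totally_disconnected (julia \<omega>))
          \<and> \<not> bounded (closure (\<Union>g\<in>Gsg c r. {g 0}))))"
proof -
  obtain ct where ct: "superattracting ct" "ct \<in> ball c r" using assms(2) by auto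
  let ?bounded = "bounded (Gsg_orbit c r 0)"
  have radius: "r \<le> r_bif c \<longleftrightarrow> ?bounded" by (rule le_r_bif_iff[OF ct])
  have orbits: "(\<forall>\<omega>\<in>Omega c r. bounded (range (\<lambda>n. seq_iter \<omega> (Suc n) 0))) \<longleftrightarrow> ?bounded"
    unfolding bounded_Gsg_orbit_iff filled_julia_iff_bounded_Suc ..
  have radius': "r > r_bif c \<longleftrightarrow> \<not> ?bounded" using radius by auto
  have closure: "bounded (closure (Gsg_orbit c r 0)) \<longleftrightarrow> ?bounded"
    using bounded_closure bounded_subset closure_subset by blast
  show ?thesis
    unfolding radius radius' orbits closure all_connected_julia_iff[OF ct]
      planar_minimal_critical_orbit_iff[OF ct] AE_critical_orbit_escapes_iff[OF ct]
      AE_totally_disconnected_julia_iff[OF ct]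
    by blast
qed

end
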